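(* Let $a,b,c\ge1$, let $W$ be the Weyl group of type $Y_{a,b,c}$, and let $n=a+b+c+1$ be its rank. (i) Let $\alpha_i$ be a simple root of $W$, and regard the stabilizer $W_{\alpha_i}=\mathrm{Stab}_W(\alpha_i)$ as a Weyl group of type $H_{a-2,b-2,c-2}$. Then the simple roots of $W_{\alpha_i}$ are precisely the $n-1$ roots that are elementary with respect to $\alpha_i$. (ii) The canonical basis $\mathcal{B}(a,b,c)$ consists of all elements $\alpha_i\vee\beta$, where $\alpha_i$ is a simple root of $W$ and $\beta$ is a simple root of the stabilizer $W_{\alpha_i}$.
   Context: $Y_{a,b,c}$ ($a,b,c\ge1$) is the tree with $n=a+b+c+1$ vertices consisting of three paths with $a$, $b$ and $c$ vertices, each joined by one of its endpoints to a common trivalent branch vertex. Its Cartan matrix $A$ has $A_{ii}=2$, $A_{ij}=-1$ if $i,j$ are adjacent, and $A_{ij}=0$ otherwise. $W$ is the group generated by $s_1,\dots,s_n$ subject to $s_i^2=1$, $s_is_j=s_js_i$ if $A_{ij}=0$, and $s_is_js_i=s_js_is_j$ if $A_{ij}=-1$. $V$ is the real vector space with basis the simple roots $\Pi=\{\alpha_1,\dots,\alpha_n\}$, with symmetric bilinear form $B(\alpha_i,\alpha_j)=A_{ij}$, on which $W$ acts by $s_i(v)=v-B(\alpha_i,v)\alpha_i$. A real root is a vector $w(\alpha_i)$ with $w\in W$; it is positive if it is a nonnegative combination of simple roots. The reflection of $\alpha=w(\alpha_i)$ is $s_\alpha=ws_iw^{-1}$, acting by $v\mapsto v-B(\alpha,v)\alpha$.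 For $\alpha,\beta\in V$, $\alpha\vee\beta=\alpha\otimes\beta+\beta\otimes\alpha$. Stabilizers. Attaching a path of length $k\ge1$ to a graph at a vertex $x$ means adding a new path with $k$ vertices with one of its endpoints joined to $x$; for $k=0$ nothing is changed; for $k=-1$ the vertex $x$ and all its edges are removed. $H_{a,b,c}$ ($a,b,c\ge-1$) is obtained from the 6-cycle $h_1$--$h_2$--$\cdots$--$h_6$--$h_1$ by attaching paths of lengths $a,b,c$ at $h_1,h_3,h_5$ respectively. By a known theorem (Allcock, Brink), $W_{\alpha_i}$ is generated by the reflections it contains (these are the $s_\beta$ with $\beta$ a real root orthogonal to $\alpha_i$) and is a simply laced Weyl group of type $H_{a-2,b-2,c-2}$. The positive roots of $W_{\alpha_i}$ are the positive real roots of $W$ orthogonal to $\alpha_i$, and its simple roots are those positive roots of $W_{\alpha_i}$ which are not expressible as a linear combination, with positive integer coefficients, of two or more positive roots of $W_{\alpha_i}$; the corresponding reflections are the Coxeter generators of $W_{\alpha_i}$. Elementary roots. The highest root of a type $D_m$ ($m\ge4$) root system is the sum of the simple roots with coefficient $1$ at the endpoints of the diagram and $2$ at all other vertices. For a simple root $\alpha_i$, a positive root $\beta$ is called elementary with respect to $\alpha_i$ if one of the following holds: (1) $\beta=\alpha_j$ is a simple root with $A_{ij}=0$; (2) $\beta=\alpha_h+\alpha_i+\alpha_j$ for a path $h$--$i$--$j$ in $Y_{a,b,c}$ (with middle vertex $i$); (3) $i$ is not the branch vertex and $\beta=\theta_i$, where $\theta_i$ is the highest root of the standard parabolic subsystem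 of type $D_m$ ($m\ge 4$) whose simple roots are those on the path from $i$ to the branch vertex together with all neighbours of the branch vertex. The canonical basis $\mathcal{B}(a,b,c)$ is the set of all $\alpha_i\vee\beta$ with $\alpha_i\in\Pi$ and $\beta$ elementary with respect to $\alpha_i$. *)

theory Defs
  imports Complex_Main "HOL-Algebra.Group"
begin

section \<open>Simply laced Weyl groups and their geometric representation\<close>

record 'v graph =
  verts :: "'v set"
  adj :: "'v \<Rightarrow> 'v \<Rightarrow> bool"

definition cartan :: "'v graph \<Rightarrow> 'v \<Rightarrow> 'v \<Rightarrow> real" where
  "cartan G i j = (if i = j then 2 else if adj G i j then - 1 else 0)"

text \<open>
  \<open>W\<close> is given by its presentation: words in the generators, modulo the congruence generated
  by the defining relations.  The generators are involutions, so no formal inverses are needed.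
\<close>

inductive word_eq :: "'v graph \<Rightarrow> 'v list \<Rightarrow> 'v list \<Rightarrow> bool" for G where
  refl: "word_eq G u u"
| sym: "word_eq G u v \<Longrightarrow> word_eq G v u"
| trans: "word_eq G u v \<Longrightarrow> word_eq G v w \<Longrightarrow> word_eq G u w"
| congruence: "word_eq G u v \<Longrightarrow> word_eq G (x @ u @ y) (x @ v @ y)"
| involution: "i \<in> verts G \<Longrightarrow> word_eq G [i, i] []"
| commute: "i \<in> verts G \<Longrightarrow> j \<in> verts G \<Longrightarrow> cartan G i j = 0 \<Longrightarrow> word_eq G [i, j] [j, i]"
| braid: "i \<in> verts G \<Longrightarrow> j \<in> verts G \<Longrightarrow> cartan G i j = - 1 \<Longrightarrow>
    word_eq G [i, j, i] [j, i, j]"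

definition word_class :: "'v graph \<Rightarrow> 'v list \<Rightarrow> 'v list set" where
  "word_class G w = {u \<in> lists (verts G). word_eq G w u}"

definition weyl_group :: "'v graph \<Rightarrow> 'v list set monoid" where
  "weyl_group G =
     \<lparr>carrier = word_class G ` lists (verts G),
      mult = (\<lambda>X Y. {w \<in> lists (verts G). \<exists>u\<in>X. \<exists>v\<in>Y. word_eq G (u @ v) w}),
      one = word_class G []\<rparr>"

text \<open>
  Vectors of \<open>V\<close> are written in coordinates with respect to the basis of simple roots, i.e. as
  functions on the vertices (vanishing outside \<open>verts G\<close>).
\<close>

definition simple_root :: "'v \<Rightarrow> 'v \<Rightarrow> real" where
  "simple_root i = (\<lambda>x. if x = i then 1 else 0)"

definition bform :: "'v graph \<Rightarrow> ('v \<Rightarrow> real) \<Rightarrow> ('v \<Rightarrow> real) \<Rightarrow> real" where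
  "bform G u v = (\<Sum>x\<in>verts G. \<Sum>y\<in>verts G. u x * cartan G x y * v y)"

definition reflect :: "'v graph \<Rightarrow> ('v \<Rightarrow> real) \<Rightarrow> ('v \<Rightarrow> real) \<Rightarrow> ('v \<Rightarrow> real)" where
  "reflect G \<alpha> v = (\<lambda>x. v x - bform G \<alpha> v * \<alpha> x)"

definition word_act :: "'v graph \<Rightarrow> 'v list \<Rightarrow> ('v \<Rightarrow> real) \<Rightarrow> ('v \<Rightarrow> real)" where
  "word_act G w v = foldr (\<lambda>i. reflect G (simple_root i)) w v"

text \<open>Independent of the chosen word, see \<open>act_word_class\<close> below.\<close>

definition act :: "'v graph \<Rightarrow> 'v list set \<Rightarrow> ('v \<Rightarrow> real) \<Rightarrow> ('v \<Rightarrow> real)" where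
  "act G X v = word_act G (SOME w. w \<in> X) v"

definition real_roots :: "'v graph \<Rightarrow> ('v \<Rightarrow> real) set" where
  "real_roots G = {act G w (simple_root i) | w i. w \<in> carrier (weyl_group G) \<and> i \<in> verts G}"

definition positive_roots :: "'v graph \<Rightarrow> ('v \<Rightarrow> real) set" where
  "positive_roots G = {\<beta> \<in> real_roots G. \<forall>x. 0 \<le> \<beta> x}"

section \<open>Stabilizers\<close>

definition stabilizer :: "'v graph \<Rightarrow> ('v \<Rightarrow> real) \<Rightarrow> 'v list set set" where
  "stabilizer G v = {w \<in> carrier (weyl_group G). act G w v = v}"

text \<open>
  The positive roots of the reflection group \<open>stabilizer G \<alpha>\<close>.  Orthogonality to \<open>\<alpha>\<close> says that the
  reflection of \<open>\<beta>\<close> lies in the stabilizer, see \<open>reflection_in_stabilizer_iff\<close> below.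
\<close>

definition stab_positive_roots :: "'v graph \<Rightarrow> ('v \<Rightarrow> real) \<Rightarrow> ('v \<Rightarrow> real) set" where
  "stab_positive_roots G \<alpha> = {\<beta> \<in> positive_roots G. bform G \<alpha> \<beta> = 0}"

definition stab_simple_roots :: "'v graph \<Rightarrow> ('v \<Rightarrow> real) \<Rightarrow> ('v \<Rightarrow> real) set" where
  "stab_simple_roots G \<alpha> =
     {\<beta> \<in> stab_positive_roots G \<alpha>.
        \<not> (\<exists>S m. finite S \<and> 2 \<le> card S \<and> S \<subseteq> stab_positive_roots G \<alpha> \<and>
             (\<forall>\<gamma>\<in>S. (0::nat) < m \<gamma>) \<and> \<beta> = (\<lambda>x. \<Sum>\<gamma>\<in>S. real (m \<gamma>) * \<gamma> x))}"

text \<open>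
  The roots in \<open>S\<close> form the simple roots of a root system of type \<open>H\<close>: their matrix of inner
  products with respect to the form of \<open>G\<close> is the Cartan matrix of \<open>H\<close>.
\<close>

definition has_type :: "'v graph \<Rightarrow> ('v \<Rightarrow> real) set \<Rightarrow> 'h graph \<Rightarrow> bool" where
  "has_type G S H \<longleftrightarrow>
     (\<exists>\<phi>. bij_betw \<phi> (verts H) S \<and>
        (\<forall>u\<in>verts H. \<forall>v\<in>verts H. bform G (\<phi> u) (\<phi> v) = cartan H u v))"

section \<open>The diagrams\<close>

datatype leg = LegA | LegB | LegC

datatype yvertex = Branch | Leg leg nat

fun leg_length :: "nat \<Rightarrow> nat \<Rightarrow> nat \<Rightarrow> leg \<Rightarrow> nat" where
  "leg_length a b c LegA = a"
| "leg_length a b c LegB = b"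
| "leg_length a b c LegC = c"

text \<open>\<open>Leg l 0\<close> is the vertex of the leg \<open>l\<close> next to the branch vertex.\<close>

fun y_adj :: "yvertex \<Rightarrow> yvertex \<Rightarrow> bool" where
  "y_adj Branch Branch = False"
| "y_adj Branch (Leg l t) = (t = 0)"
| "y_adj (Leg l t) Branch = (t = 0)"
| "y_adj (Leg l t) (Leg l' t') = (l = l' \<and> (t' = Suc t \<or> t = Suc t'))"

definition Y_diagram :: "nat \<Rightarrow> nat \<Rightarrow> nat \<Rightarrow> yvertex graph" where
  "Y_diagram a b c =
     \<lparr>verts = insert Branch {Leg l t | l t. t < leg_length a b c l}, adj = y_adj\<rparr>"

text \<open>
  \<open>(k, 0)\<close> is the vertex \<open>h\<^sub>k\<close> of the 6-cycle and \<open>(k, t)\<close> with \<open>t \<ge> 1\<close> is the \<open>t\<close>-th vertex of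
  the path attached at \<open>h\<^sub>k\<close>.  With attached length \<open>-1\<close> no \<open>(k, t)\<close> is left, so that \<open>h\<^sub>k\<close> itself
  is removed.
\<close>

definition h_length :: "int \<Rightarrow> int \<Rightarrow> int \<Rightarrow> nat \<Rightarrow> int" where
  "h_length a b c k = (if k = 1 then a else if k = 3 then b else if k = 5 then c else 0)"

definition h_adj :: "nat \<times> nat \<Rightarrow> nat \<times> nat \<Rightarrow> bool" where
  "h_adj p q \<longleftrightarrow>
     (fst p = fst q \<and> (snd q = Suc (snd p) \<or> snd p = Suc (snd q))) \<or>
     (snd p = 0 \<and> snd q = 0 \<and> (fst q = fst p mod 6 + 1 \<or> fst p = fst q mod 6 + 1))"

definition H_diagram :: "int \<Rightarrow> int \<Rightarrow> int \<Rightarrow> (nat \<times> nat) graph" where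
  "H_diagram a b c =
     \<lparr>verts = {(k, t). k \<in> {1..6} \<and> int t \<le> h_length a b c k}, adj = h_adj\<rparr>"

section \<open>Elementary roots and the canonical basis\<close>

fun path_to_branch :: "yvertex \<Rightarrow> yvertex set" where
  "path_to_branch Branch = {Branch}"
| "path_to_branch (Leg l t) = insert Branch {Leg l s | s. s \<le> t}"

definition D_subdiagram :: "nat \<Rightarrow> nat \<Rightarrow> nat \<Rightarrow> yvertex \<Rightarrow> yvertex set" where
  "D_subdiagram a b c i =
     path_to_branch i \<union> {x \<in> verts (Y_diagram a b c). adj (Y_diagram a b c) Branch x}"

text \<open>The highest root of a standard parabolic subsystem of type \<open>D\<^sub>m\<close> with simple roots \<open>D\<close>.\<close>

definition D_highest_root :: "'v graph \<Rightarrow> 'v set \<Rightarrow> 'v \<Rightarrow> real" where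
  "D_highest_root G D =
     (\<lambda>x. if x \<in> D then (if card {y \<in> D. adj G x y} = 1 then 1 else 2) else 0)"

definition elementary_roots :: "nat \<Rightarrow> nat \<Rightarrow> nat \<Rightarrow> yvertex \<Rightarrow> (yvertex \<Rightarrow> real) set" where
  "elementary_roots a b c i =
     {\<beta> \<in> positive_roots (Y_diagram a b c).
        (\<exists>j\<in>verts (Y_diagram a b c). cartan (Y_diagram a b c) i j = 0 \<and> \<beta> = simple_root j) \<or>
        (\<exists>h\<in>verts (Y_diagram a b c). \<exists>j\<in>verts (Y_diagram a b c).
           h \<noteq> j \<and> adj (Y_diagram a b c) h i \<and> adj (Y_diagram a b c) i j \<and>
           \<beta> = (\<lambda>x. simple_root h x + simple_root i x + simple_root j x)) \<or>
        (i \<noteq> Branch \<and> \<beta> = D_highest_root (Y_diagram a b c) (D_subdiagram a b c i))}"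

text \<open>
  \<open>\<alpha> \<otimes> \<beta> + \<beta> \<otimes> \<alpha>\<close>, where tensors in \<open>V \<otimes> V\<close> are written in coordinates with respect to the
  basis of the \<open>\<alpha>\<^sub>i \<otimes> \<alpha>\<^sub>j\<close>.
\<close>

definition sym_product :: "('v \<Rightarrow> real) \<Rightarrow> ('v \<Rightarrow> real) \<Rightarrow> 'v \<times> 'v \<Rightarrow> real" where
  "sym_product \<alpha> \<beta> = (\<lambda>(x, y). \<alpha> x * \<beta> y + \<beta> x * \<alpha> y)"

definition canonical_basis :: "nat \<Rightarrow> nat \<Rightarrow> nat \<Rightarrow> (yvertex \<times> yvertex \<Rightarrow> real) set" where
  "canonical_basis a b c =
     {sym_product (simple_root i) \<beta> | i \<beta>.
        i \<in> verts (Y_diagram a b c) \<and> \<beta> \<in> elementary_roots a b c i}"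

section \<open>Sanity lemmas\<close>

subsection \<open>The group \<open>W\<close>\<close>

lemma word_eq_append:
  assumes "word_eq G u u'" and "word_eq G v v'"
  shows "word_eq G (u @ v) (u' @ v')"
proof -
  have "word_eq G (u @ v) (u' @ v)"
    using word_eq.congruence[OF assms(1), of "[]" v] by simp
  moreover have "word_eq G (u' @ v) (u' @ v')"
    using word_eq.congruence[OF assms(2), of u' "[]"] by simp
  ultimately show ?thesis by (rule word_eq.trans)
qed

lemma word_eq_rev_left: "u \<in> lists (verts G) \<Longrightarrow> word_eq G (rev u @ u) []"
proof (induction u)
  case Nil
  show ?case by (simp add: word_eq.refl)
next
  case (Cons i u)
  have "word_eq G (rev u @ [i, i] @ u) (rev u @ [] @ u)"
    using Cons.prems by (intro word_eq.congruence word_eq.involution) simp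
  with Cons show ?case by (auto intro: word_eq.trans)
qed

lemma word_class_eq:
  assumes "word_eq G u v"
  shows "word_class G u = word_class G v"
  unfolding word_class_def using assms by (auto intro: word_eq.trans word_eq.sym)

lemma mult_word_class:
  assumes "u \<in> lists (verts G)" and "v \<in> lists (verts G)"
  shows "word_class G u \<otimes>\<^bsub>weyl_group G\<^esub> word_class G v = word_class G (u @ v)"
proof -
  have "word_eq G (u @ v) w"
    if "word_eq G u u'" "word_eq G v v'" "word_eq G (u' @ v') w" for u' v' w
    using word_eq_append[OF that(1,2)] that(3) by (rule word_eq.trans)
  moreover have "\<exists>u'\<in>lists (verts G). word_eq G u u' \<and>
      (\<exists>v'\<in>lists (verts G). word_eq G v v' \<and> word_eq G (u' @ v') w)"
    if "word_eq G (u @ v) w" for w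
    using that assms by (blast intro: word_eq.refl)
  ultimately show ?thesis
    unfolding weyl_group_def word_class_def by fastforce
qed

lemma weyl_group_group: "group (weyl_group G)"
proof (rule groupI)
  fix x y assume "x \<in> carrier (weyl_group G)" "y \<in> carrier (weyl_group G)"
  then obtain u v where uv: "u \<in> lists (verts G)" "v \<in> lists (verts G)"
    and [simp]: "x = word_class G u" "y = word_class G v"
    by (auto simp: weyl_group_def)
  have "u @ v \<in> lists (verts G)" using uv by simp
  then have "word_class G (u @ v) \<in> carrier (weyl_group G)"
    by (simp add: weyl_group_def)
  then show "x \<otimes>\<^bsub>weyl_group G\<^esub> y \<in> carrier (weyl_group G)"
    by (simp add: mult_word_class uv)
next
  show "\<one>\<^bsub>weyl_group G\<^esub> \<in> carrier (weyl_group G)" by (simp add: weyl_group_def)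
next
  fix x y z
  assume "x \<in> carrier (weyl_group G)" "y \<in> carrier (weyl_group G)" "z \<in> carrier (weyl_group G)"
  then obtain u v w
    where uvw: "u \<in> lists (verts G)" "v \<in> lists (verts G)" "w \<in> lists (verts G)"
      and [simp]: "x = word_class G u" "y = word_class G v" "z = word_class G w"
    by (auto simp: weyl_group_def)
  have "u @ v \<in> lists (verts G)" "v @ w \<in> lists (verts G)" using uvw by simp_all
  then show "x \<otimes>\<^bsub>weyl_group G\<^esub> y \<otimes>\<^bsub>weyl_group G\<^esub> z =
      x \<otimes>\<^bsub>weyl_group G\<^esub> (y \<otimes>\<^bsub>weyl_group G\<^esub> z)"
    using uvw by (simp add: mult_word_class del: append_in_lists_conv)
next
  fix x assume "x \<in> carrier (weyl_group G)"
  then obtain u where u: "u \<in> lists (verts G)" and [simp]: "x = word_class G u"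
    by (auto simp: weyl_group_def)
  have one: "\<one>\<^bsub>weyl_group G\<^esub> = word_class G []" by (simp add: weyl_group_def)
  show "\<one>\<^bsub>weyl_group G\<^esub> \<otimes>\<^bsub>weyl_group G\<^esub> x = x"
    using u by (simp add: one mult_word_class)
  have ru: "rev u \<in> lists (verts G)" using u by (simp add: in_lists_conv_set)
  have "word_class G (rev u) \<otimes>\<^bsub>weyl_group G\<^esub> x = \<one>\<^bsub>weyl_group G\<^esub>"
    using mult_word_class[OF ru u] word_class_eq[OF word_eq_rev_left[OF u]] by (simp add: one)
  moreover have "word_class G (rev u) \<in> carrier (weyl_group G)"
    using ru by (simp add: weyl_group_def)
  ultimately show "\<exists>y\<in>carrier (weyl_group G). y \<otimes>\<^bsub>weyl_group G\<^esub> x = \<one>\<^bsub>weyl_group G\<^esub>"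
    by blast
qed

lemma inv_word_class:
  assumes "u \<in> lists (verts G)"
  shows "inv\<^bsub>weyl_group G\<^esub> (word_class G u) = word_class G (rev u)"
proof -
  interpret group "weyl_group G" by (rule weyl_group_group)
  have ru: "rev u \<in> lists (verts G)" using assms by (simp add: in_lists_conv_set)
  have "word_class G (rev u) \<otimes>\<^bsub>weyl_group G\<^esub> word_class G u = \<one>\<^bsub>weyl_group G\<^esub>"
    using mult_word_class[OF ru assms] word_class_eq[OF word_eq_rev_left[OF assms]]
    by (simp add: weyl_group_def)
  moreover have "word_class G u \<in> carrier (weyl_group G)"
    "word_class G (rev u) \<in> carrier (weyl_group G)"
    using assms ru by (simp_all add: weyl_group_def)
  ultimately show ?thesis by (intro inv_equality)
qed

subsection \<open>The action\<close>

lemma bform_simple_left: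
  assumes "finite (verts G)" and "i \<in> verts G"
  shows "bform G (simple_root i) v = (\<Sum>y\<in>verts G. cartan G i y * v y)"
proof -
  have "bform G (simple_root i) v =
      (\<Sum>x\<in>verts G. if x = i then (\<Sum>y\<in>verts G. cartan G i y * v y) else 0)"
    unfolding bform_def simple_root_def by (intro sum.cong) auto
  then show ?thesis using assms by simp
qed

lemma bform_simple_simple:
  assumes "finite (verts G)" and "i \<in> verts G" and "j \<in> verts G"
  shows "bform G (simple_root i) (simple_root j) = cartan G i j"
  unfolding bform_simple_left[OF assms(1,2)]
  using assms by (simp add: simple_root_def if_distrib[of "\<lambda>t. _ * t"] cong: if_cong)

lemma bform_lin_right:
  "bform G u (\<lambda>x. v x - c * w x) = bform G u v - c * bform G u w"
  by (simp add: bform_def algebra_simps sum_subtractf sum_distrib_left)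

lemma bform_lin_left:
  "bform G (\<lambda>x. v x - c * w x) u = bform G v u - c * bform G w u"
  by (simp add: bform_def algebra_simps sum_subtractf sum_distrib_left)

lemma bform_sym:
  assumes "\<And>x y. adj G x y = adj G y x"
  shows "bform G u v = bform G v u"
proof -
  have "cartan G x y = cartan G y x" for x y
    using assms[of x y] by (simp add: cartan_def)
  then show ?thesis
    unfolding bform_def by (subst sum.swap) (simp add: mult_ac)
qed

lemma word_act_append: "word_act G (u @ v) x = word_act G u (word_act G v x)"
  by (simp add: word_act_def)

lemma word_act_cong:
  assumes "finite (verts G)" and "\<And>x y. adj G x y = adj G y x"
  shows "word_eq G u v \<Longrightarrow> word_act G u x = word_act G v x"
proof (induction arbitrary: x rule: word_eq.induct)
  case (involution i)
  then show ?case
    using bform_simple_simple[OF assms(1), of i i]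
    by (simp add: word_act_def reflect_def bform_lin_right cartan_def)
next
  case (commute i j)
  then have "cartan G j i = 0"
    using assms(2)[of i j] by (auto simp: cartan_def split: if_splits)
  with commute show ?case
    using bform_simple_simple[OF assms(1), of i j] bform_simple_simple[OF assms(1), of j i]
    by (simp add: word_act_def reflect_def bform_lin_right) (simp add: algebra_simps)
next
  case (braid i j)
  then have "cartan G j i = - 1"
    using assms(2)[of i j] by (auto simp: cartan_def split: if_splits)
  with braid show ?case
    using bform_simple_simple[OF assms(1), of i j] bform_simple_simple[OF assms(1), of j i]
      bform_simple_simple[OF assms(1), of i i] bform_simple_simple[OF assms(1), of j j]
    by (simp add: word_act_def reflect_def bform_lin_right) (simp add: cartan_def algebra_simps)
qed (simp_all add: word_act_append)

lemma act_word_class: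
  assumes "finite (verts G)" and "\<And>x y. adj G x y = adj G y x" and "w \<in> lists (verts G)"
  shows "act G (word_class G w) v = word_act G w v"
proof -
  have "w \<in> word_class G w" using assms(3) by (simp add: word_class_def word_eq.refl)
  then have "(SOME u. u \<in> word_class G w) \<in> word_class G w" by (rule someI)
  then have "word_eq G w (SOME u. u \<in> word_class G w)" by (simp add: word_class_def)
  then show ?thesis
    unfolding act_def using word_act_cong[OF assms(1,2)] by metis
qed

lemma bform_word_act:
  assumes "finite (verts G)" and "\<And>x y. adj G x y = adj G y x" and "w \<in> lists (verts G)"
  shows "bform G (word_act G w u) (word_act G w v) = bform G u v"
  using assms(3)
proof (induction w rule: list.induct)
  case Nil
  show ?case by (simp add: word_act_def)
next
  case (Cons i w)
  have "bform G (reflect G (simple_root i) u) (reflect G (simple_root i) v) = bform G u v" for u v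
    using bform_simple_simple[OF assms(1), of i i] Cons.prems
      bform_sym[OF assms(2), of u "simple_root i"]
    by (simp add: reflect_def bform_lin_right bform_lin_left cartan_def)
  with Cons show ?case by (simp add: word_act_def)
qed

subsection \<open>Reflections in stabilizers\<close>

lemma word_act_lin:
  "word_act G w (\<lambda>x. u x - c * v x) = (\<lambda>x. word_act G w u x - c * word_act G w v x)"
proof (induction w arbitrary: u v)
  case Nil
  show ?case by (simp add: word_act_def)
next
  case (Cons i w)
  then show ?case
    by (simp add: word_act_def reflect_def bform_lin_right algebra_simps)
qed

lemma act_reflection:
  assumes fin: "finite (verts G)" and sm: "\<And>x y. adj G x y = adj G y x"
    and w: "w \<in> carrier (weyl_group G)" and i: "i \<in> verts G"
  shows "act G (w \<otimes>\<^bsub>weyl_group G\<^esub> word_class G [i] \<otimes>\<^bsub>weyl_group G\<^esub> inv\<^bsub>weyl_group G\<^esub> w) v =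
    reflect G (act G w (simple_root i)) v"
proof -
  obtain u where u: "u \<in> lists (verts G)" and [simp]: "w = word_class G u"
    using w by (auto simp: weyl_group_def)
  have ru: "rev u \<in> lists (verts G)" using u by (simp add: in_lists_conv_set)
  have i': "[i] \<in> lists (verts G)" using i by simp
  have ui: "u @ [i] \<in> lists (verts G)" and uir: "(u @ [i]) @ rev u \<in> lists (verts G)"
    using u ru i by auto
  have "word_eq G (rev (rev u) @ rev u) []"
    by (rule word_eq_rev_left[OF ru])
  then have uru: "word_act G u (word_act G (rev u) v) = v"
    using word_act_cong[OF fin sm, of "u @ rev u" "[]" v]
    by (simp add: word_act_append) (simp add: word_act_def)
  have "act G (w \<otimes>\<^bsub>weyl_group G\<^esub> word_class G [i] \<otimes>\<^bsub>weyl_group G\<^esub> inv\<^bsub>weyl_group G\<^esub> w) v =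
      word_act G ((u @ [i]) @ rev u) v"
    using act_word_class[OF fin sm uir, of v] mult_word_class[OF u i']
      mult_word_class[OF ui ru] inv_word_class[OF u] by simp
  also have "\<dots> = word_act G u (reflect G (simple_root i) (word_act G (rev u) v))"
    by (simp only: word_act_append) (simp add: word_act_def)
  also have "\<dots> = (\<lambda>x. v x -
      bform G (simple_root i) (word_act G (rev u) v) * word_act G u (simple_root i) x)"
    unfolding reflect_def word_act_lin uru ..
  also have "bform G (simple_root i) (word_act G (rev u) v) = bform G (word_act G u (simple_root i)) v"
    using bform_word_act[OF fin sm u, of "simple_root i" "word_act G (rev u) v"] uru by simp
  finally show ?thesis
    by (simp add: reflect_def act_word_class[OF fin sm u])
qed

lemma reflection_in_stabilizer_iff:
  assumes fin: "finite (verts G)" and sm: "\<And>x y. adj G x y = adj G y x"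
    and w: "w \<in> carrier (weyl_group G)" and i: "i \<in> verts G"
  shows "w \<otimes>\<^bsub>weyl_group G\<^esub> word_class G [i] \<otimes>\<^bsub>weyl_group G\<^esub> inv\<^bsub>weyl_group G\<^esub> w \<in> stabilizer G \<alpha> \<longleftrightarrow>
    bform G \<alpha> (act G w (simple_root i)) = 0" (is "?r \<in> _ \<longleftrightarrow> bform G \<alpha> ?\<beta> = 0")
proof -
  interpret group "weyl_group G" by (rule weyl_group_group)
  have "word_class G [i] \<in> carrier (weyl_group G)" using i by (simp add: weyl_group_def)
  then have "?r \<in> carrier (weyl_group G)" using w by simp
  then have "?r \<in> stabilizer G \<alpha> \<longleftrightarrow> reflect G ?\<beta> \<alpha> = \<alpha>"
    unfolding stabilizer_def using act_reflection[OF assms] by simp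
  also have "\<dots> \<longleftrightarrow> (\<forall>x. bform G ?\<beta> \<alpha> * ?\<beta> x = 0)"
    by (auto simp: reflect_def fun_eq_iff)
  also have "\<dots> \<longleftrightarrow> bform G ?\<beta> \<alpha> = 0"
  proof -
    obtain u where u: "u \<in> lists (verts G)" and "w = word_class G u"
      using w by (auto simp: weyl_group_def)
    then have "bform G ?\<beta> ?\<beta> = 2"
      using bform_word_act[OF fin sm u, of "simple_root i" "simple_root i"]
        bform_simple_simple[OF fin i i]
      by (simp add: act_word_class[OF fin sm u] cartan_def)
    moreover have "bform G ?\<beta> ?\<beta> = 0" if "\<forall>x. ?\<beta> x = 0"
      using that by (simp add: bform_def)
    ultimately show ?thesis by auto
  qed
  finally show ?thesis by (simp add: bform_sym[OF sm, of ?\<beta> \<alpha>])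
qed

subsection \<open>The diagram \<open>Y\<close>\<close>

lemma adj_Y_sym: "adj (Y_diagram a b c) x y = adj (Y_diagram a b c) y x"
  by (cases x; cases y) (auto simp: Y_diagram_def)

lemma finite_verts_Y: "finite (verts (Y_diagram a b c))"
  and card_verts_Y: "card (verts (Y_diagram a b c)) = a + b + c + 1"
proof -
  have eq: "verts (Y_diagram a b c) =
      insert Branch (Leg LegA ` {..<a} \<union> (Leg LegB ` {..<b} \<union> Leg LegC ` {..<c}))" (is "_ = ?V")
    unfolding Y_diagram_def
    by (auto simp: image_iff) (metis leg.exhaust leg_length.simps)+
  show "finite (verts (Y_diagram a b c))" unfolding eq by simp
  have inj: "inj_on (Leg l) X" for l X by (auto simp: inj_on_def)
  have "card (Leg LegB ` {..<b} \<union> Leg LegC ` {..<c}) = b + c"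
    by (subst card_Un_disjoint) (auto simp: card_image inj)
  then have "card (Leg LegA ` {..<a} \<union> (Leg LegB ` {..<b} \<union> Leg LegC ` {..<c})) = a + (b + c)"
    by (subst card_Un_disjoint) (auto simp: card_image inj)
  then show "card (verts (Y_diagram a b c)) = a + b + c + 1"
    unfolding eq by (subst card_insert_disjoint) auto
qed

end

theory Submission
  imports Defs
begin

text \<open>
  Two adjacent vertices \<open>i\<close>, \<open>j\<close> generate a subgroup of type \<open>A\<^sub>2\<close>, in which \<open>s\<^sub>js\<^sub>i\<close> carries
  \<open>\<alpha>\<^sub>j\<close> to \<open>\<alpha>\<^sub>i\<close>.  The only positive roots that \<open>s\<^sub>js\<^sub>i\<close> makes negative are \<open>\<alpha>\<^sub>i\<close> and
  \<open>\<alpha>\<^sub>i + \<alpha>\<^sub>j\<close>, and neither is orthogonal to \<open>\<alpha>\<^sub>j\<close>.  Hence \<open>s\<^sub>js\<^sub>i\<close> (called \<open>slide j i\<close>) identifies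
  the positive roots of the stabilizer of \<open>\<alpha>\<^sub>j\<close> with those of the stabilizer of \<open>\<alpha>\<^sub>i\<close>.

  This reduces the theorem to a stability statement.  Suppose that a finite set \<open>E\<^sub>i\<close> is given for every
  vertex \<open>i\<close>, that \<open>E\<^sub>i\<close> contains the simple roots orthogonal to \<open>\<alpha>\<^sub>i\<close>, and that slides carry
  \<open>E\<^sub>j\<close> into \<open>E\<^sub>i\<close>.  Then every positive root \<open>\<beta>\<close> orthogonal to \<open>\<alpha>\<^sub>i\<close> is a sum of elements of \<open>E\<^sub>i\<close>,
  by induction on the height of \<open>\<beta>\<close>: choose \<open>j\<close> with \<open>B(\<alpha>\<^sub>j, \<beta>) > 0\<close>.  If \<open>j\<close> is not adjacent to
  \<open>i\<close>, subtract a multiple of \<open>\<alpha>\<^sub>j \<in> E\<^sub>i\<close>; otherwise slide \<open>\<beta>\<close> to \<open>j\<close>, which lowers its height, and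
  slide the resulting sum back (\<open>stab_positive_in_nat_span\<close>).  If moreover some linear functional
  has value 1 on all of \<open>E\<^sub>i\<close>, then it is at least 1 on every positive root of the stabilizer, so that no
  element of \<open>E\<^sub>i\<close> decomposes, and \<open>E\<^sub>i\<close> is the set of simple roots (\<open>stab_simple_roots_eqI\<close>).

  For the tree, the elementary roots are stable under slides (\<open>slide_elementary\<close>): the three kinds turn
  into one another along an edge, and the highest root of type \<open>D\<^sub>4\<close> arises from
  \<open>\<alpha>\<^sub>h + \<alpha>\<^sub>j + \<alpha>\<^sub>k\<close> on the edge from the branch vertex \<open>j\<close> to its third neighbour.  Slides are isometries and
  the tree is connected, so the number of elementary roots, their Gram matrix and the existence of the
  functional need only be checked at the branch vertex.  There the three roots \<open>\<alpha>\<^sub>h + \<alpha>\<^sub>i + \<alpha>\<^sub>j\<close>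
  and the simple roots of the vertices at distance 2 form the hexagon of the diagram \<open>H\<close>, with a gap for
  each leg that consists of one vertex.

  All of this rests on the fact that real roots are positive or negative.  In the simply laced case this
  has a direct proof by induction on the height (\<open>pos_sref\<close>).
\<close>

section \<open>Positive roots of a simply laced Weyl group\<close>

locale simply_laced =
  fixes G :: "'v graph"
  assumes fin: "finite (verts G)" and adj_sym: "\<And>x y. adj G x y = adj G y x"
begin

abbreviation pairing :: "'v \<Rightarrow> ('v \<Rightarrow> real) \<Rightarrow> real" where
  "pairing i v \<equiv> bform G (simple_root i) v"

abbreviation sref :: "'v \<Rightarrow> ('v \<Rightarrow> real) \<Rightarrow> ('v \<Rightarrow> real)" where
  "sref i v \<equiv> reflect G (simple_root i) v"

lemma simple_root_eq: "simple_root i i = 1" "x \<noteq> i \<Longrightarrow> simple_root i x = 0"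
  by (simp_all add: simple_root_def)

lemma cartan_sym: "cartan G i j = cartan G j i"
  using adj_sym[of i j] by (simp add: cartan_def)

lemma cartan_cases:
  obtains "i = j" "cartan G i j = 2" | "i \<noteq> j" "cartan G i j = 0" | "i \<noteq> j" "cartan G i j = - 1"
proof -
  consider "i = j" | "i \<noteq> j" "adj G i j" | "i \<noteq> j" "\<not> adj G i j" by blast
  then show ?thesis by cases (auto intro: that simp: cartan_def)
qed

lemma pairing_simple: "i \<in> verts G \<Longrightarrow> j \<in> verts G \<Longrightarrow> pairing i (simple_root j) = cartan G i j"
  by (rule bform_simple_simple[OF fin])

lemma sref_apply: "sref i v x = v x - pairing i v * simple_root i x"
  by (simp add: reflect_def)

lemma pairing_sref:
  "k \<in> verts G \<Longrightarrow> i \<in> verts G \<Longrightarrow> pairing k (sref i v) = pairing k v - pairing i v * cartan G k i"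
  by (simp add: reflect_def bform_lin_right pairing_simple)

lemma sref_sref: "i \<in> verts G \<Longrightarrow> sref i (sref i v) = v"
  by (rule ext) (simp add: reflect_def bform_lin_right pairing_simple cartan_def)

lemma bform_sref:
  "i \<in> verts G \<Longrightarrow> bform G (sref i u) (sref i v) = bform G u v"
  using bform_word_act[OF fin adj_sym, of "[i]" u v] by (simp add: word_act_def)

lemma bform_expand: "bform G u v = (\<Sum>x\<in>verts G. u x * pairing x v)"
proof -
  have "bform G u v = (\<Sum>x\<in>verts G. u x * (\<Sum>y\<in>verts G. cartan G x y * v y))"
    by (simp add: bform_def sum_distrib_left mult_ac)
  also have "\<dots> = (\<Sum>x\<in>verts G. u x * pairing x v)"
    by (intro sum.cong) (simp_all add: bform_simple_left[OF fin])
  finally show ?thesis .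
qed

text \<open>
  These are the positive real roots (\<open>positive_roots_eq\<close>), generated from below: each step adds a
  positive multiple of a simple root, so that positivity of the coordinates is evident and what needs
  proof is stability under simple reflections.
\<close>

inductive pos :: "('v \<Rightarrow> real) \<Rightarrow> bool" where
  simple: "i \<in> verts G \<Longrightarrow> pos (simple_root i)"
| raise: "pos \<beta> \<Longrightarrow> j \<in> verts G \<Longrightarrow> pairing j \<beta> < 0 \<Longrightarrow> pos (sref j \<beta>)"

lemma pos_nonneg: "pos \<beta> \<Longrightarrow> 0 \<le> \<beta> x"
proof (induction rule: pos.induct)
  case (raise \<beta> j)
  then have "0 \<le> - pairing j \<beta> * simple_root j x" by (simp add: simple_root_def)
  with raise show ?case by (simp add: reflect_def)
qed (simp add: simple_root_def)

lemma cartan_Ints: "cartan G i j \<in> \<int>"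
  by (simp add: cartan_def)

lemma pairing_Ints: "i \<in> verts G \<Longrightarrow> (\<And>x. v x \<in> \<int>) \<Longrightarrow> pairing i v \<in> \<int>"
  by (auto simp: bform_simple_left[OF fin] intro!: Ints_sum Ints_mult cartan_Ints)

lemma pos_Ints: "pos \<beta> \<Longrightarrow> \<beta> x \<in> \<int>"
proof (induction arbitrary: x rule: pos.induct)
  case (raise \<beta> j)
  then show ?case
    by (cases "x = j") (simp_all add: sref_apply Ints_diff pairing_Ints simple_root_eq)
qed (simp add: simple_root_def)

lemma pos_norm: "pos \<beta> \<Longrightarrow> bform G \<beta> \<beta> = 2"
  by (induction rule: pos.induct) (simp_all add: pairing_simple cartan_def bform_sref)

lemma pos_nonzero: "pos \<beta> \<Longrightarrow> \<beta> \<noteq> (\<lambda>x. 0)"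
  using pos_norm[of \<beta>] by (auto simp: bform_def)

lemma pos_pairing_ge_1: "pos \<beta> \<Longrightarrow> j \<in> verts G \<Longrightarrow> 0 < pairing j \<beta> \<Longrightarrow> 1 \<le> pairing j \<beta>"
  using pairing_Ints[of j \<beta>] pos_Ints[of \<beta>] by (auto elim!: Ints_cases)

definition height :: "('v \<Rightarrow> real) \<Rightarrow> real" where
  "height v = (\<Sum>x\<in>verts G. v x)"

lemma height_simple: "i \<in> verts G \<Longrightarrow> height (simple_root i) = 1"
  using fin by (simp add: height_def simple_root_def)

lemma height_sref: "i \<in> verts G \<Longrightarrow> height (sref i v) = height v - pairing i v"
  using height_simple[of i]
  by (simp add: height_def reflect_def sum_subtractf flip: sum_distrib_left)

lemma height_nonneg: "pos \<beta> \<Longrightarrow> 0 \<le> height \<beta>"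
  by (simp add: height_def sum_nonneg pos_nonneg)

text \<open>
  Heights of roots are integers, but coordinates are real; inductions on the height therefore use its
  integer part as a measure.
\<close>

lemma height_descent:
  assumes "pos \<gamma>" and "height \<gamma> + 1 \<le> height \<beta>"
  shows "nat \<lfloor>height \<gamma>\<rfloor> < nat \<lfloor>height \<beta>\<rfloor>"
proof -
  have "\<lfloor>height \<gamma>\<rfloor> + 1 \<le> \<lfloor>height \<beta>\<rfloor>" using assms(2) by linarith
  moreover have "0 \<le> \<lfloor>height \<gamma>\<rfloor>" using height_nonneg[OF assms(1)] by simp
  ultimately show ?thesis by linarith
qed

text \<open>
  Only the case \<open>B(\<alpha>\<^sub>j, \<beta>) > 0\<close> is not immediate.  Let \<open>\<beta> = s\<^sub>k\<gamma>\<close> with \<open>\<gamma>\<close> of smaller height.  If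
  \<open>s\<^sub>j\<close> and \<open>s\<^sub>k\<close> commute, \<open>s\<^sub>j\<gamma>\<close> is a positive root by induction and \<open>s\<^sub>k\<close> raises it.  If they braid,
  induction applies to \<open>\<gamma>\<close> and to \<open>s\<^sub>j\<gamma>\<close>, which has still smaller height, and the braid relation
  leads from \<open>s\<^sub>ks\<^sub>j\<gamma>\<close> up to \<open>s\<^sub>j\<beta>\<close>.
\<close>

lemma pos_sref:
  assumes "pos \<beta>" and "j \<in> verts G" and "\<beta> \<noteq> simple_root j"
  shows "pos (sref j \<beta>)"
  using assms
proof (induction "nat \<lfloor>height \<beta>\<rfloor>" arbitrary: \<beta> j rule: less_induct)
  case less
  note j = less.prems(2)
  consider "pairing j \<beta> < 0" | "pairing j \<beta> = 0" | "pairing j \<beta> > 0" by linarith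
  then show ?case
  proof cases
    case 1
    then show ?thesis using less.prems by (intro pos.raise)
  next
    case 2
    then have "sref j \<beta> = \<beta>" by (simp add: reflect_def)
    then show ?thesis using less.prems by simp
  next
    case 3
    from less.prems(1) show ?thesis
    proof cases
      case (simple i)
      then show ?thesis
        using 3 j less.prems(3) by (auto simp: pairing_simple cartan_def split: if_splits)
    next
      case (raise \<gamma> k)
      note k = \<open>k \<in> verts G\<close> and \<gamma> = \<open>pos \<gamma>\<close> and \<beta> = \<open>\<beta> = sref k \<gamma>\<close>
      have pk: "pairing k \<gamma> \<le> - 1"
        using pairing_Ints[OF k, of \<gamma>] pos_Ints[OF \<gamma>] raise(4) by (auto elim!: Ints_cases)
      have ht: "nat \<lfloor>height \<gamma>\<rfloor> < nat \<lfloor>height \<beta>\<rfloor>"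
        using pk by (intro height_descent \<gamma>) (simp add: \<beta> height_sref k)
      have kk: "cartan G k k = 2" "cartan G j j = 2" by (simp_all add: cartan_def)
      have pj: "pairing j \<beta> = pairing j \<gamma> - pairing k \<gamma> * cartan G j k"
        by (simp add: \<beta> pairing_sref j k)
      show ?thesis
      proof (cases rule: cartan_cases[of j k])
        case 1
        then show ?thesis using \<gamma> by (simp add: \<beta> sref_sref k)
      next
        case 2
        then have c: "cartan G k j = 0" using cartan_sym by metis
        have "\<gamma> \<noteq> simple_root j" using pk c by (auto simp: pairing_simple j k)
        then have "pos (sref j \<gamma>)" using less.hyps[OF ht \<gamma> j] by blast
        then have "pos (sref k (sref j \<gamma>))"
          using pk c by (intro pos.raise[OF _ k]) (simp_all add: pairing_sref j k)
        moreover have "sref k (sref j \<gamma>) = sref j \<beta>"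
          using 2 c unfolding \<beta>
          by (intro ext) (simp add: sref_apply pairing_sref pairing_simple j k)
        ultimately show ?thesis by simp
      next
        case 3
        then have c: "cartan G k j = - 1" using cartan_sym by metis
        have up: "0 < pairing j \<gamma> + pairing k \<gamma>" using pj \<open>pairing j \<beta> > 0\<close> 3 by simp
        show ?thesis
        proof (cases "\<gamma> = simple_root j")
          case True
          then have "sref j \<beta> = simple_root k"
            using 3 c unfolding \<beta>
            by (intro ext) (simp add: sref_apply pairing_sref pairing_simple j k kk)
          then show ?thesis by (simp add: pos.simple k)
        next
          case False
          define \<delta> where "\<delta> = sref j \<gamma>"
          have \<delta>: "pos \<delta>" unfolding \<delta>_def using less.hyps[OF ht \<gamma> j False] .
          have "1 \<le> pairing j \<gamma>" using up pk by linarith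
          then have ht': "nat \<lfloor>height \<delta>\<rfloor> < nat \<lfloor>height \<gamma>\<rfloor>"
            by (intro height_descent \<delta>) (simp add: \<delta>_def height_sref j)
          have "\<delta> \<noteq> simple_root k"
          proof
            assume "\<delta> = simple_root k"
            then have "\<gamma> = sref j (simple_root k)" by (metis \<delta>_def sref_sref j)
            then show False using pk 3 c by (simp add: pairing_sref pairing_simple j k kk)
          qed
          then have \<epsilon>: "pos (sref k \<delta>)"
            using less.hyps[OF _ \<delta> k] ht ht' by simp
          \<comment> \<open>\<open>s\<^sub>j\<beta> = s\<^sub>js\<^sub>k\<gamma> = s\<^sub>ks\<^sub>js\<^sub>ks\<^sub>j\<gamma>\<close>, and the last two of these reflections raise the height.\<close>
          have "pos (sref j (sref k \<delta>))"
            using pk c 3 up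
            by (intro pos.raise[OF \<epsilon> j]) (simp add: \<delta>_def pairing_sref j k kk)
          then have "pos (sref k (sref j (sref k \<delta>)))"
            using pk c 3 up
            by (intro pos.raise[OF _ k]) (simp_all add: \<delta>_def pairing_sref j k kk)
          moreover have "sref k (sref j (sref k \<delta>)) = sref j \<beta>"
            unfolding \<beta> \<delta>_def using 3 c
            by (intro ext) (simp add: sref_apply pairing_sref pairing_simple j k kk algebra_simps)
          ultimately show ?thesis by simp
        qed
      qed
    qed
  qed
qed

lemma real_roots_word_act:
  "real_roots G = {word_act G w (simple_root i) | w i. w \<in> lists (verts G) \<and> i \<in> verts G}"
proof -
  have "real_roots G = {act G (word_class G w) (simple_root i) | w i. w \<in> lists (verts G) \<and> i \<in> verts G}"
    unfolding real_roots_def by (auto simp: weyl_group_def)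
  also have "\<dots> = {word_act G w (simple_root i) | w i. w \<in> lists (verts G) \<and> i \<in> verts G}"
    using act_word_class[OF fin adj_sym] by (metis (no_types, lifting))
  finally show ?thesis .
qed

text \<open>
  A simple reflection permutes the positive roots other than \<open>\<alpha>\<^sub>j\<close> and negates \<open>\<alpha>\<^sub>j\<close>, so the dichotomy
  is preserved along any word.
\<close>

lemma real_root_sign:
  assumes "w \<in> lists (verts G)" and "i \<in> verts G"
  shows "pos (word_act G w (simple_root i)) \<or> pos (\<lambda>x. - word_act G w (simple_root i) x)"
  using assms(1)
proof (induction w rule: list.induct)
  case Nil
  show ?case using assms(2) by (simp add: word_act_def pos.simple)
next
  case (Cons j w)
  define \<beta> where "\<beta> = word_act G w (simple_root i)"
  have j: "j \<in> verts G" using Cons.prems by simp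
  have step: "word_act G (j # w) (simple_root i) = sref j \<beta>"
    by (simp add: \<beta>_def word_act_def)
  have neg: "sref j (\<lambda>x. - v x) = (\<lambda>x. - sref j v x)" for v
    by (simp add: reflect_def fun_eq_iff bform_def sum_negf)
  have flip: "sref j (simple_root j) = (\<lambda>x. - simple_root j x)"
    by (simp add: reflect_def pairing_simple j cartan_def fun_eq_iff)
  have *: "pos (sref j v) \<or> pos (\<lambda>x. - sref j v x)" if "pos v" for v
    using pos_sref[OF that j] pos.simple[OF j] flip by (cases "v = simple_root j") auto
  have "pos \<beta> \<or> pos (\<lambda>x. - \<beta> x)" using Cons by (simp add: \<beta>_def)
  then show ?case
    unfolding step using *[of \<beta>] *[of "\<lambda>x. - \<beta> x"] unfolding neg by auto
qed

lemma positive_roots_eq: "positive_roots G = Collect pos"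
proof (intro subset_antisym subsetI CollectI)
  fix \<beta> assume \<beta>: "\<beta> \<in> positive_roots G"
  then have "pos \<beta> \<or> pos (\<lambda>x. - \<beta> x)"
    using real_root_sign by (auto simp: positive_roots_def real_roots_word_act)
  moreover have False if n: "pos (\<lambda>x. - \<beta> x)"
  proof -
    have "\<beta> x = 0" for x
      using pos_nonneg[OF n, of x] \<beta> by (force simp: positive_roots_def intro: antisym)
    then show False using pos_nonzero[OF n] by simp
  qed
  ultimately show "pos \<beta>" by blast
next
  fix \<beta> assume "\<beta> \<in> Collect pos"
  then have "pos \<beta>" by simp
  then have "\<beta> \<in> real_roots G"
  proof (induction rule: pos.induct)
    case (simple i)
    have "simple_root i = word_act G [] (simple_root i)" by (simp add: word_act_def)
    with simple show ?case unfolding real_roots_word_act by blast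
  next
    case (raise \<beta> j)
    then obtain w i where w: "w \<in> lists (verts G)" "i \<in> verts G" "\<beta> = word_act G w (simple_root i)"
      unfolding real_roots_word_act by blast
    have "sref j \<beta> = word_act G (j # w) (simple_root i)" by (simp add: w(3) word_act_def)
    moreover have "j # w \<in> lists (verts G)" using w raise by simp
    ultimately show ?case unfolding real_roots_word_act using w(2) by blast
  qed
  then show "\<beta> \<in> positive_roots G"
    using pos_nonneg[OF \<open>pos \<beta>\<close>] by (simp add: positive_roots_def)
qed

lemma stab_positive_iff:
  "\<beta> \<in> stab_positive_roots G (simple_root i) \<longleftrightarrow> pos \<beta> \<and> pairing i \<beta> = 0"
  by (simp add: stab_positive_roots_def positive_roots_eq)

text \<open>
  Otherwise \<open>B(\<beta>, \<beta>)\<close>, a nonnegative combination of the \<open>B(\<alpha>\<^sub>j, \<beta>)\<close>, would not be 2.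
\<close>

lemma pos_lowerable:
  assumes "pos \<beta>"
  obtains j where "j \<in> verts G" "0 < pairing j \<beta>"
proof -
  have "\<not> (\<forall>x\<in>verts G. pairing x \<beta> \<le> 0)"
  proof
    assume "\<forall>x\<in>verts G. pairing x \<beta> \<le> 0"
    then have "(\<Sum>x\<in>verts G. \<beta> x * pairing x \<beta>) \<le> 0"
      using pos_nonneg[OF assms] by (intro sum_nonpos) (simp add: mult_nonneg_nonpos)
    then have "bform G \<beta> \<beta> \<le> 0" using bform_expand[of \<beta> \<beta>] by simp
    then show False using pos_norm[OF assms] by simp
  qed
  then show ?thesis using that by force
qed

section \<open>Sliding the stabilized root along an edge\<close>

text \<open>
  For adjacent \<open>i\<close> and \<open>j\<close> this carries \<open>\<alpha>\<^sub>j\<close> to \<open>\<alpha>\<^sub>i\<close>, hence the stabilizer of \<open>\<alpha>\<^sub>j\<close> to that of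
  \<open>\<alpha>\<^sub>i\<close>; the inverse is \<open>slide i j\<close>.
\<close>

definition slide :: "'v \<Rightarrow> 'v \<Rightarrow> ('v \<Rightarrow> real) \<Rightarrow> ('v \<Rightarrow> real)" where
  "slide j i = word_act G [j, i]"

lemma slide_sref: "slide j i v = sref j (sref i v)"
  by (simp add: slide_def word_act_def)

lemma slide_slide: "i \<in> verts G \<Longrightarrow> j \<in> verts G \<Longrightarrow> slide i j (slide j i v) = v"
  by (simp add: slide_sref sref_sref)

lemma bform_slide: "i \<in> verts G \<Longrightarrow> j \<in> verts G \<Longrightarrow> bform G (slide j i u) (slide j i v) = bform G u v"
  by (simp add: slide_sref bform_sref)

lemma slide_eq:
  assumes "i \<in> verts G" "j \<in> verts G" "cartan G i j = - 1" "pairing j v = 0"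
  shows "slide j i v = (\<lambda>x. v x - pairing i v * (simple_root i x + simple_root j x))"
  using assms cartan_sym[of i j]
  by (intro ext) (simp add: slide_sref sref_apply pairing_sref pairing_simple algebra_simps)

lemma slide_simple:
  assumes "i \<in> verts G" "j \<in> verts G" "cartan G i j = - 1"
  shows "slide j i (simple_root j) = simple_root i"
  using assms cartan_sym[of i j]
  by (intro ext)
    (simp add: slide_sref sref_apply pairing_sref pairing_simple cartan_def split: if_splits)

lemma slide_orthogonal:
  assumes "i \<in> verts G" "j \<in> verts G" "cartan G i j = - 1"
  shows "pairing i (slide j i v) = pairing j v"
  using bform_slide[OF assms(1,2), of "simple_root j" v] slide_simple[OF assms] by simp

text \<open>
  A simple reflection makes only its own simple root negative.  This would require \<open>v = \<alpha>\<^sub>i\<close> in the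
  first step or \<open>v = s\<^sub>i\<alpha>\<^sub>j = \<alpha>\<^sub>i + \<alpha>\<^sub>j\<close> in the second, and neither is orthogonal to \<open>\<alpha>\<^sub>j\<close>.
\<close>

lemma slide_pos:
  assumes "i \<in> verts G" "j \<in> verts G" "cartan G i j = - 1" "pos v" "pairing j v = 0"
  shows "pos (slide j i v)"
proof -
  have c: "cartan G j i = - 1" using assms(3) cartan_sym by metis
  have "v \<noteq> simple_root i" using assms c by (auto simp: pairing_simple)
  then have p: "pos (sref i v)" using pos_sref assms by blast
  have "sref i v \<noteq> simple_root j"
  proof
    assume "sref i v = simple_root j"
    then have "v = sref i (simple_root j)" using sref_sref assms(1) by metis
    then have "pairing j v = 1"
      using assms c by (simp add: pairing_sref pairing_simple) (simp add: cartan_def)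
    then show False using assms(5) by simp
  qed
  then show ?thesis using pos_sref[OF p] assms(2) by (simp add: slide_sref)
qed

lemma slide_stab_positive:
  assumes "i \<in> verts G" "j \<in> verts G" "cartan G i j = - 1"
    and "v \<in> stab_positive_roots G (simple_root j)"
  shows "slide j i v \<in> stab_positive_roots G (simple_root i)"
  using assms slide_pos[OF assms(1-3)] slide_orthogonal[OF assms(1-3)]
  by (simp add: stab_positive_iff)

lemma word_act_sum:
  assumes "finite S"
  shows "word_act G w (\<lambda>x. \<Sum>\<gamma>\<in>S. c \<gamma> * g \<gamma> x) = (\<lambda>x. \<Sum>\<gamma>\<in>S. c \<gamma> * word_act G w (g \<gamma>) x)"
  using assms
proof (induction S)
  case empty
  show ?case using word_act_lin[of G w "\<lambda>x. 0" 1 "\<lambda>x. 0"] by simp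
next
  case (insert \<gamma> S)
  then show ?case
    using word_act_lin[of G w "\<lambda>x. \<Sum>\<gamma>\<in>S. c \<gamma> * g \<gamma> x" "- c \<gamma>" "g \<gamma>"]
    by (simp add: add_ac)
qed

end

section \<open>Indecomposable roots of a stabilizer\<close>

definition nat_span :: "('v \<Rightarrow> real) set \<Rightarrow> ('v \<Rightarrow> real) set" where
  "nat_span E = {(\<lambda>x. \<Sum>e\<in>E. real (m e) * e x) | m. True}"

lemma nat_span_zero: "(\<lambda>x. 0) \<in> nat_span E"
  unfolding nat_span_def by (rule CollectI, rule exI[of _ "\<lambda>_. 0"]) simp

lemma nat_span_add_multiple:
  assumes "finite E" "u \<in> nat_span E" "e \<in> E"
  shows "(\<lambda>x. u x + real k * e x) \<in> nat_span E"
proof -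
  obtain m where m: "u = (\<lambda>x. \<Sum>e\<in>E. real (m e) * e x)"
    using assms(2) by (auto simp: nat_span_def)
  have "(\<Sum>f\<in>E. real (if f = e then k else 0) * f x) = real k * e x" for x
  proof -
    have "(\<Sum>f\<in>E. real (if f = e then k else 0) * f x) = (\<Sum>f\<in>E. if f = e then real k * e x else 0)"
      by (intro sum.cong) auto
    then show ?thesis using assms(1,3) by simp
  qed
  then have "(\<lambda>x. u x + real k * e x) = (\<lambda>x. \<Sum>f\<in>E. real (m f + (if f = e then k else 0)) * f x)"
    unfolding m by (simp add: distrib_right sum.distrib)
  then show ?thesis
    unfolding nat_span_def by (intro CollectI exI[of _ "\<lambda>f. m f + (if f = e then k else 0)"]) simp
qed

lemma nat_span_sum:
  assumes "finite E" "finite F" "\<And>f. f \<in> F \<Longrightarrow> g f \<in> E"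
  shows "(\<lambda>x. \<Sum>f\<in>F. real (m f) * g f x) \<in> nat_span E"
  using assms(2,3)
proof (induction F)
  case empty
  show ?case by (simp add: nat_span_zero)
next
  case (insert f F)
  then show ?case
    using nat_span_add_multiple[OF assms(1), of "\<lambda>x. \<Sum>f\<in>F. real (m f) * g f x" "g f" "m f"]
    by (simp add: add_ac)
qed

context simply_laced
begin

text \<open>
  Any \<open>\<alpha>\<^sub>j\<close> with \<open>B(\<alpha>\<^sub>j, \<beta>) = k > 0\<close> permits a descent that stays among roots orthogonal to the current
  simple root: \<open>\<beta> - k\<alpha>\<^sub>j\<close> is again orthogonal to \<open>\<alpha>\<^sub>i\<close> if \<open>i\<close> and \<open>j\<close> are not adjacent, and otherwise the
  slide \<open>\<beta> - k(\<alpha>\<^sub>i + \<alpha>\<^sub>j)\<close> is orthogonal to \<open>\<alpha>\<^sub>j\<close>.  The vertex changes in the second case, which is why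
  the sets \<open>E i\<close> have to be treated for all \<open>i\<close> at once.
\<close>

lemma stab_positive_in_nat_span:
  assumes finE: "\<And>i. i \<in> verts G \<Longrightarrow> finite (E i)"
    and simple: "\<And>i j. i \<in> verts G \<Longrightarrow> j \<in> verts G \<Longrightarrow> cartan G i j = 0 \<Longrightarrow> simple_root j \<in> E i"
    and slide: "\<And>i j e. i \<in> verts G \<Longrightarrow> j \<in> verts G \<Longrightarrow> cartan G i j = - 1 \<Longrightarrow> e \<in> E j \<Longrightarrow>
      slide j i e \<in> E i"
    and "i \<in> verts G" "\<beta> \<in> stab_positive_roots G (simple_root i)"
  shows "\<beta> \<in> nat_span (E i)"
proof -
  have "pos \<beta>" "pairing i \<beta> = 0" using assms(5) by (simp_all add: stab_positive_iff)
  then show ?thesis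
    using assms(4)
  proof (induction "nat \<lfloor>height \<beta>\<rfloor>" arbitrary: \<beta> i rule: less_induct)
    case less
    note i = less.prems(3)
    obtain j where j: "j \<in> verts G" and pj: "0 < pairing j \<beta>"
      using pos_lowerable[OF less.prems(1)] .
    have pj1: "1 \<le> pairing j \<beta>" using pos_pairing_ge_1 less.prems(1) j pj by blast
    obtain k :: nat where k: "pairing j \<beta> = real k"
    proof -
      have "pairing j \<beta> \<in> \<int>" using pairing_Ints[OF j] pos_Ints[OF less.prems(1)] by blast
      then obtain z where "pairing j \<beta> = of_int z" by (auto elim: Ints_cases)
      then have "pairing j \<beta> = real (nat z)" using pj by simp
      then show thesis by (rule that)
    qed
    show ?case
    proof (cases rule: cartan_cases[of i j])
      case 1
      then show ?thesis using less.prems(2) pj by simp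
    next
      case 2
      note ej = simple[OF i j 2(2)]
      show ?thesis
      proof (cases "\<beta> = simple_root j")
        case True
        then show ?thesis
          using nat_span_add_multiple[OF finE[OF i] nat_span_zero ej, of 1] by simp
      next
        case False
        define \<gamma> where "\<gamma> = sref j \<beta>"
        have p: "pos \<gamma>" unfolding \<gamma>_def using pos_sref[OF less.prems(1) j False] .
        have "nat \<lfloor>height \<gamma>\<rfloor> < nat \<lfloor>height \<beta>\<rfloor>"
          using pj1 by (intro height_descent p) (simp add: \<gamma>_def height_sref j)
        moreover have "pairing i \<gamma> = 0"
          using less.prems 2 by (simp add: \<gamma>_def pairing_sref j)
        ultimately have "\<gamma> \<in> nat_span (E i)" using less.hyps p i by blast
        from nat_span_add_multiple[OF finE[OF i] this ej, of k]
        show ?thesis by (simp add: \<gamma>_def reflect_def k)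
      qed
    next
      case 3
      then have c: "cartan G j i = - 1" using cartan_sym by metis
      define \<gamma> where "\<gamma> = slide i j \<beta>"
      have p: "pos \<gamma>" unfolding \<gamma>_def using slide_pos[OF j i c] less.prems by blast
      have o: "pairing j \<gamma> = 0"
        unfolding \<gamma>_def slide_orthogonal[OF j i c] by (rule less.prems)
      have "height \<gamma> = height \<beta> - 2 * pairing j \<beta>"
        using less.prems(2) c 3 by (simp add: \<gamma>_def slide_sref height_sref pairing_sref i j)
      then have "nat \<lfloor>height \<gamma>\<rfloor> < nat \<lfloor>height \<beta>\<rfloor>"
        using pj1 by (intro height_descent p) simp
      then have "\<gamma> \<in> nat_span (E j)" using less.hyps p o j by blast
      then obtain m where "\<gamma> = (\<lambda>x. \<Sum>e\<in>E j. real (m e) * e x)" by (auto simp: nat_span_def)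
      moreover have "\<beta> = slide j i \<gamma>" by (simp add: \<gamma>_def slide_slide i j)
      ultimately have "\<beta> = (\<lambda>x. \<Sum>e\<in>E j. real (m e) * slide j i e x)"
        by (simp add: slide_def word_act_sum finE j)
      then show ?thesis
        using nat_span_sum[OF finE[OF i] finE[OF j] slide[OF i j 3(2)]] by simp
    qed
  qed
qed

text \<open>
  The summands \<open>g \<gamma>\<close> are indexed by vectors because decompositions of roots are sums over sets of roots;
  allowing \<open>g\<close> to be any map makes the notion stable under composition with slides.
\<close>

definition linear_functional :: "(('v \<Rightarrow> real) \<Rightarrow> real) \<Rightarrow> bool" where
  "linear_functional f \<longleftrightarrow>
     (\<forall>S c g. finite (S :: ('v \<Rightarrow> real) set) \<longrightarrow>
       f (\<lambda>x. \<Sum>\<gamma>\<in>S. c \<gamma> * g \<gamma> x) = (\<Sum>\<gamma>\<in>S. c \<gamma> * f (g \<gamma>)))"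

text \<open>
  A simple root of the stabilizer is a positive integer multiple of a single element of \<open>E\<close>, and equal to
  it because both have norm 2.  Conversely \<open>f\<close> is at least 1 on each positive root of the stabilizer, as it
  counts the elements of \<open>E\<close> in a decomposition, whereas a decomposable element of \<open>E\<close> would need at least
  2.
\<close>

lemma stab_simple_roots_eqI:
  assumes finE: "finite E" and E: "E \<subseteq> stab_positive_roots G (simple_root i)"
    and span: "stab_positive_roots G (simple_root i) \<subseteq> nat_span E"
    and f: "linear_functional f" and f1: "\<And>e. e \<in> E \<Longrightarrow> f e = 1"
  shows "stab_simple_roots G (simple_root i) = E"
proof (intro subset_antisym subsetI)
  fix \<beta> assume \<beta>: "\<beta> \<in> stab_simple_roots G (simple_root i)"
  then have "\<beta> \<in> stab_positive_roots G (simple_root i)" by (simp add: stab_simple_roots_def)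
  then have p: "pos \<beta>" and "\<beta> \<in> nat_span E" using span by (auto simp: stab_positive_iff)
  then obtain m where m: "\<beta> = (\<lambda>x. \<Sum>e\<in>E. real (m e) * e x)" by (auto simp: nat_span_def)
  define S where "S = {e \<in> E. 0 < m e}"
  have S: "finite S" "S \<subseteq> E" "\<forall>e\<in>S. 0 < m e" using finE by (auto simp: S_def)
  have mS: "\<beta> = (\<lambda>x. \<Sum>e\<in>S. real (m e) * e x)"
    unfolding m S_def using finE by (intro ext sum.mono_neutral_right) auto
  have "\<not> 2 \<le> card S"
  proof
    assume "2 \<le> card S"
    then have "\<exists>S m. finite S \<and> 2 \<le> card S \<and> S \<subseteq> stab_positive_roots G (simple_root i) \<and>
        (\<forall>\<gamma>\<in>S. (0::nat) < m \<gamma>) \<and> \<beta> = (\<lambda>x. \<Sum>\<gamma>\<in>S. real (m \<gamma>) * \<gamma> x)"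
      using S E mS by (intro exI[of _ S] exI[of _ m] conjI) auto
    then show False using \<beta> unfolding stab_simple_roots_def by blast
  qed
  moreover have "card S \<noteq> 0" using mS pos_nonzero[OF p] S by auto
  ultimately have "card S = 1" by linarith
  then obtain e where e: "S = {e}" by (auto simp: card_1_singleton_iff)
  then have "e \<in> E" and \<beta>e: "\<beta> = (\<lambda>x. real (m e) * e x)" using S mS by auto
  have "pos e" using \<open>e \<in> E\<close> E by (auto simp: stab_positive_iff)
  have "bform G \<beta> \<beta> = real (m e) * real (m e) * bform G e e"
    unfolding \<beta>e bform_def by (simp add: sum_distrib_left mult_ac)
  then have "real (m e) * real (m e) = 1" using pos_norm[OF p] pos_norm[OF \<open>pos e\<close>] by simp
  then have "m e = 1" by (simp flip: of_nat_mult)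
  then show "\<beta> \<in> E" using \<beta>e \<open>e \<in> E\<close> by simp
next
  fix e assume e: "e \<in> E"
  have ge: "1 \<le> f \<gamma>" if "\<gamma> \<in> stab_positive_roots G (simple_root i)" for \<gamma>
  proof -
    have "pos \<gamma>" "\<gamma> \<in> nat_span E" using that span by (auto simp: stab_positive_iff)
    then obtain m where m: "\<gamma> = (\<lambda>x. \<Sum>e\<in>E. real (m e) * e x)" by (auto simp: nat_span_def)
    have "f \<gamma> = real (\<Sum>e\<in>E. m e)"
      using f finE f1 unfolding m linear_functional_def by simp
    moreover have "(\<Sum>e\<in>E. m e) \<noteq> 0"
    proof
      assume "(\<Sum>e\<in>E. m e) = 0"
      then have "\<gamma> = (\<lambda>x. 0)" unfolding m using finE by simp
      then show False using pos_nonzero \<open>pos \<gamma>\<close> by blast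
    qed
    ultimately show ?thesis by linarith
  qed
  have indec: False if S: "finite S" "2 \<le> card S" "S \<subseteq> stab_positive_roots G (simple_root i)"
    "\<forall>\<gamma>\<in>S. (0::nat) < m \<gamma>" and eq: "e = (\<lambda>x. \<Sum>\<gamma>\<in>S. real (m \<gamma>) * \<gamma> x)" for S m
  proof -
    have "f e = (\<Sum>\<gamma>\<in>S. real (m \<gamma>) * f \<gamma>)"
      unfolding eq using f S(1) by (simp add: linear_functional_def)
    moreover have "(\<Sum>\<gamma>\<in>S. (1::real)) \<le> (\<Sum>\<gamma>\<in>S. real (m \<gamma>) * f \<gamma>)"
    proof (rule sum_mono)
      fix \<gamma> assume "\<gamma> \<in> S"
      then have "0 < m \<gamma>" "\<gamma> \<in> stab_positive_roots G (simple_root i)" using S(3,4) by blast+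
      then have "1 \<le> real (m \<gamma>)" "1 \<le> f \<gamma>" using ge by auto
      then show "1 \<le> real (m \<gamma>) * f \<gamma>" using mult_mono[of 1 "real (m \<gamma>)" 1 "f \<gamma>"] by simp
    qed
    ultimately show False using S(2) f1[OF e] by simp
  qed
  then show "e \<in> stab_simple_roots G (simple_root i)"
    using e E indec unfolding stab_simple_roots_def by blast
qed

lemma linear_functional_slide:
  "linear_functional f \<Longrightarrow> linear_functional (\<lambda>v. f (slide i j v))"
  by (simp add: linear_functional_def slide_def word_act_sum)

end

section \<open>Neighbours in the tree\<close>

locale Y_tree =
  fixes a b c :: nat
  assumes leg_lengths: "1 \<le> a" "1 \<le> b" "1 \<le> c"
begin

abbreviation Y :: "yvertex graph" where
  "Y \<equiv> Y_diagram a b c"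

sublocale simply_laced Y
  by unfold_locales (auto simp: finite_verts_Y adj_Y_sym)

lemma adj_Y: "adj Y = y_adj"
  by (simp add: Y_diagram_def)

lemma Branch_in [simp]: "Branch \<in> verts Y"
  and Leg_in: "Leg l t \<in> verts Y \<longleftrightarrow> t < leg_length a b c l"
  by (simp_all add: Y_diagram_def)

lemma leg_nonempty [simp]: "0 < leg_length a b c l"
  using leg_lengths by (cases l) simp_all

lemma leg_length_nonzero [simp]: "leg_length a b c l \<noteq> 0"
  using leg_nonempty[of l] by linarith

lemma Leg_0_in [simp]: "Leg l 0 \<in> verts Y"
  by (simp add: Leg_in)

lemma cartan_Y: "cartan Y i j = (if i = j then 2 else if y_adj i j then - 1 else 0)"
  by (simp add: cartan_def adj_Y)

lemma y_adj_irrefl: "\<not> y_adj i i"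
  by (cases i) auto

lemma y_adj_sym: "y_adj i j = y_adj j i"
  by (cases i; cases j) auto

lemma cartan_Y_edge: "cartan Y i j = - 1 \<longleftrightarrow> y_adj i j"
  using y_adj_irrefl by (auto simp: cartan_Y)

lemma third_leg: "l \<noteq> LegA \<Longrightarrow> l \<noteq> LegB \<Longrightarrow> l = LegC"
  by (cases l) auto

lemma two_other_legs:
  fixes l :: leg
  obtains l' l'' where "l \<noteq> l'" "l \<noteq> l''" "l' \<noteq> l''"
  using that[of LegB LegC] that[of LegA LegC] that[of LegA LegB] by (cases l) simp_all

fun inward :: "yvertex \<Rightarrow> yvertex" where
  "inward (Leg l (Suc t)) = Leg l t"
| "inward _ = Branch"

lemma y_adj_Leg: "y_adj (Leg l t) x \<longleftrightarrow> x = inward (Leg l t) \<or> x = Leg l (Suc t)"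
  by (cases x; cases t) auto

text \<open>
  At the end of a leg the vertex \<open>Leg l (Suc t)\<close> does not exist; the formula holds there as well because
  \<open>v\<close> vanishes outside the tree.
\<close>

lemma pairing_Leg:
  assumes "Leg l t \<in> verts Y" and out: "\<And>x. x \<notin> verts Y \<Longrightarrow> v x = 0"
  shows "pairing (Leg l t) v = 2 * v (Leg l t) - v (inward (Leg l t)) - v (Leg l (Suc t))"
proof -
  have "pairing (Leg l t) v = (\<Sum>y\<in>verts Y. cartan Y (Leg l t) y * v y)"
    by (simp add: bform_simple_left[OF fin assms(1)])
  also have "\<dots> = (\<Sum>y\<in>{Leg l t, inward (Leg l t), Leg l (Suc t)}. cartan Y (Leg l t) y * v y)"
  proof (rule sum.mono_neutral_cong[OF _ fin])
    show "finite {Leg l t, inward (Leg l t), Leg l (Suc t)}" by simp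
    show "cartan Y (Leg l t) i * v i = 0"
      if "i \<in> {Leg l t, inward (Leg l t), Leg l (Suc t)} - verts Y" for i
      using that out by auto
    show "cartan Y (Leg l t) i * v i = 0"
      if "i \<in> verts Y - {Leg l t, inward (Leg l t), Leg l (Suc t)}" for i
      using that by (auto simp: cartan_Y y_adj_Leg)
  qed simp
  also have "\<dots> = 2 * v (Leg l t) - v (inward (Leg l t)) - v (Leg l (Suc t))"
    by (cases t) (simp_all add: cartan_Y)
  finally show ?thesis .
qed

text \<open>
  Every vertex is joined to the branch vertex, so a property that passes along edges need only be
  checked there.
\<close>

lemma Y_vertex_induct [consumes 1, case_names Branch edge]:
  assumes "i \<in> verts Y" and "P Branch"
    and step: "\<And>i j. i \<in> verts Y \<Longrightarrow> j \<in> verts Y \<Longrightarrow> y_adj i j \<Longrightarrow> P j \<Longrightarrow> P i"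
  shows "P i"
proof (cases i)
  case Branch
  then show ?thesis using assms(2) by simp
next
  case (Leg l t)
  have "P (Leg l t)" if "Leg l t \<in> verts Y" for t
    using that
  proof (induction t)
    case 0
    then show ?case using step[of "Leg l 0" Branch] assms(2) by simp
  next
    case (Suc t)
    then have "Leg l t \<in> verts Y" by (simp add: Leg_in)
    then show ?case using Suc step[of "Leg l (Suc t)" "Leg l t"] by simp
  qed
  then show ?thesis using Leg assms(1) by simp
qed

lemma no_triangle: "y_adj i j \<Longrightarrow> y_adj j k \<Longrightarrow> \<not> y_adj i k"
  by (cases i; cases j; cases k) auto

lemma three_neighbours:
  assumes "y_adj j h" "y_adj j i" "y_adj j k" "h \<noteq> i" "h \<noteq> k" "i \<noteq> k"
  shows "j = Branch"
  using assms by (cases j) (auto simp: y_adj_Leg)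

section \<open>Elementary roots\<close>

text \<open>
  The highest root \<open>\<theta>\<^sub>i\<close> of type \<open>D\<close> in a form without cardinalities (\<open>D_highest_root_theta\<close>).
\<close>

fun theta :: "yvertex \<Rightarrow> yvertex \<Rightarrow> real" where
  "theta (Leg l t) Branch = 2"
| "theta (Leg l t) (Leg l' s) =
     (if l' = l then if s < t then 2 else if s = t then 1 else 0 else if s = 0 then 1 else 0)"
| "theta Branch _ = 0"

lemma theta_outside:
  assumes "i \<in> verts Y" "x \<notin> verts Y"
  shows "theta i x = 0"
proof (cases i)
  case (Leg l t)
  then show ?thesis
    using assms by (cases x) (auto simp: Leg_in intro!: gr0I)
qed (use assms in auto)

lemma D_subdiagram_Leg:
  "D_subdiagram a b c (Leg l t) = insert Branch ({Leg l s | s. s \<le> t} \<union> range (\<lambda>l'. Leg l' 0))"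
proof -
  have "x \<in> range (\<lambda>l'. Leg l' 0) \<longleftrightarrow> x \<in> verts Y \<and> y_adj Branch x" for x
    by (cases x) auto
  then show ?thesis by (auto simp: D_subdiagram_def adj_Y)
qed

lemma D_highest_root_theta:
  assumes "i \<noteq> Branch"
  shows "D_highest_root Y (D_subdiagram a b c i) = theta i"
proof
  fix x
  obtain l t where i: "i = Leg l t" using assms by (cases i) auto
  let ?D = "D_subdiagram a b c i"
  note D = D_subdiagram_Leg[of l t]
  show "D_highest_root Y ?D x = theta i x"
  proof (cases "x \<in> ?D")
    case False
    then show ?thesis unfolding i D D_highest_root_def
      by (cases x) (auto simp: image_iff)
  next
    case True
    show ?thesis
    proof (cases x)
      case Branch
      have "{y \<in> ?D. y_adj x y} = {Leg LegA 0, Leg LegB 0, Leg LegC 0}"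
        unfolding i D Branch by (auto intro: third_leg)
      then show ?thesis using True by (simp add: D_highest_root_def adj_Y Branch i)
    next
      case (Leg l' s)
      show ?thesis
      proof (cases "l' = l \<and> s < t")
        case True
        then have "{y \<in> ?D. y_adj x y} = {inward (Leg l s), Leg l (Suc s)}"
          unfolding i D Leg by (cases s) (auto simp: y_adj_Leg)
        moreover have "inward (Leg l s) \<noteq> Leg l (Suc s)" by (cases s) auto
        ultimately show ?thesis
          using True \<open>x \<in> ?D\<close> by (simp add: D_highest_root_def adj_Y Leg i)
      next
        case False
        then have "{y \<in> ?D. y_adj x y} = {inward (Leg l' s)}"
          using \<open>x \<in> ?D\<close> unfolding i D Leg by (cases s) (auto simp: y_adj_Leg)
        then show ?thesis
          using False \<open>x \<in> ?D\<close> unfolding i D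
          by (auto simp: D_highest_root_def adj_Y Leg D)
      qed
    qed
  qed
qed

text \<open>
  The elementary roots, without the condition that they be positive real roots.  That they are follows
  from their stability under slides (\<open>elementary_roots_eq\<close>).
\<close>

definition elementary :: "yvertex \<Rightarrow> (yvertex \<Rightarrow> real) set" where
  "elementary i =
     {simple_root j | j. j \<in> verts Y \<and> cartan Y i j = 0} \<union>
     {(\<lambda>x. simple_root h x + simple_root i x + simple_root j x) | h j.
        h \<in> verts Y \<and> j \<in> verts Y \<and> h \<noteq> j \<and> y_adj h i \<and> y_adj i j} \<union>
     (if i = Branch then {} else {theta i})"

lemma elementary_cases:
  assumes "e \<in> elementary i"
  obtains (simple) j where "j \<in> verts Y" "cartan Y i j = 0" "e = simple_root j"
  | (path) h j where "h \<in> verts Y" "j \<in> verts Y" "h \<noteq> j" "y_adj i h" "y_adj i j"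
      "e = (\<lambda>x. simple_root h x + simple_root i x + simple_root j x)"
  | (theta) "i \<noteq> Branch" "e = theta i"
proof -
  consider j where "j \<in> verts Y" "cartan Y i j = 0" "e = simple_root j"
    | h j where "h \<in> verts Y" "j \<in> verts Y" "h \<noteq> j" "y_adj h i" "y_adj i j"
      "e = (\<lambda>x. simple_root h x + simple_root i x + simple_root j x)"
    | "i \<noteq> Branch" "e = theta i"
    using assms unfolding elementary_def by (auto split: if_splits)
  then show thesis
    by cases (use simple path theta y_adj_sym in blast)+
qed

lemma elementary_simple: "j \<in> verts Y \<Longrightarrow> cartan Y i j = 0 \<Longrightarrow> simple_root j \<in> elementary i"
  unfolding elementary_def by blast

lemma elementary_path:
  assumes "h \<in> verts Y" "j \<in> verts Y" "h \<noteq> j" "y_adj i h" "y_adj i j"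
  shows "(\<lambda>x. simple_root h x + simple_root i x + simple_root j x) \<in> elementary i"
proof -
  have "y_adj h i" using assms y_adj_sym by blast
  then show ?thesis unfolding elementary_def using assms by blast
qed

lemma elementary_theta: "i \<noteq> Branch \<Longrightarrow> theta i \<in> elementary i"
  unfolding elementary_def by simp

lemma finite_elementary: "finite (elementary i)"
proof -
  let ?P = "{(\<lambda>x. simple_root h x + simple_root i x + simple_root j x) | h j.
    h \<in> verts Y \<and> j \<in> verts Y}"
  have "finite ?P" by (rule finite_image_set2) (simp_all add: fin)
  moreover have "elementary i \<subseteq> simple_root ` verts Y \<union> ?P \<union> {theta i}"
    unfolding elementary_def by (intro Un_least) (blast, blast, simp)
  ultimately show ?thesis by (meson fin finite.emptyI finite.insertI finite_UnI finite_imageI finite_subset)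
qed

lemma pairing_path:
  assumes "k \<in> verts Y" "h \<in> verts Y" "i \<in> verts Y" "j \<in> verts Y"
  shows "pairing k (\<lambda>x. simple_root h x + simple_root i x + simple_root j x) =
    cartan Y k h + cartan Y k i + cartan Y k j"
  using bform_lin_right[of Y "simple_root k" "\<lambda>x. simple_root h x + simple_root i x" "- 1" "simple_root j"]
    bform_lin_right[of Y "simple_root k" "simple_root h" "- 1" "simple_root i"]
  by (simp add: pairing_simple assms)

lemma elementary_orthogonal:
  assumes i: "i \<in> verts Y" and "e \<in> elementary i"
  shows "pairing i e = 0"
  using assms(2)
proof (cases rule: elementary_cases)
  case (simple j)
  then show ?thesis using i by (simp add: pairing_simple)
next
  case (path h j)
  then show ?thesis using i y_adj_irrefl by (auto simp: pairing_path cartan_Y)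
next
  case theta
  then obtain l t where l: "i = Leg l t" by (cases i) auto
  have "pairing i (theta i) = 0"
    using pairing_Leg[of l t "theta i"] theta_outside[OF i] i unfolding l by (cases t) auto
  then show ?thesis using theta by simp
qed

lemma theta_Suc:
  "theta (Leg l (Suc t)) x = theta (Leg l t) x + (simple_root (Leg l (Suc t)) x + simple_root (Leg l t) x)"
  by (cases x) (auto simp: simple_root_def)

lemma slide_theta_outward:
  assumes j: "j \<in> verts Y" "j = Leg l t" and i: "i \<in> verts Y" "i = Leg l (Suc t)"
  shows "slide j i (theta j) = theta i"
proof -
  have "pairing i (theta j) = - 1"
    using pairing_Leg[of l "Suc t" "theta j"] theta_outside[OF j(1)] i unfolding j i by simp
  moreover have "cartan Y i j = - 1" "pairing j (theta j) = 0"
    using elementary_orthogonal[OF j(1) elementary_theta] j i by (simp_all add: cartan_Y)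
  ultimately show ?thesis
    using slide_eq[OF i(1) j(1), of "theta j"]
    by (simp add: fun_eq_iff theta_Suc i(2) j(2) del: theta.simps)
qed

lemma slide_theta_inward:
  assumes j: "j \<in> verts Y" "j = Leg l (Suc t)" and i: "i \<in> verts Y" "i = Leg l t"
  shows "slide j i (theta j) = theta i"
proof -
  have "slide j i (theta j) = slide j i (slide i j (theta i))"
    using slide_theta_outward[OF i j] by simp
  then show ?thesis using slide_slide[OF j(1) i(1)] by simp
qed

text \<open>
  The origin of \<open>\<theta>\<^sub>i\<close> for \<open>i\<close> next to the branch vertex: sliding along the edge from the branch vertex to
  \<open>i\<close> adds \<open>\<alpha>\<^sub>i\<close> and the root of the branch vertex to the path through the two other neighbours.
\<close>

lemma slide_path_to_theta:
  assumes "i = Leg l 0" "h = Leg l' 0" "k = Leg l'' 0" "l \<noteq> l'" "l \<noteq> l''" "l' \<noteq> l''"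
  shows "slide Branch i (\<lambda>x. simple_root h x + simple_root Branch x + simple_root k x) = theta i"
proof -
  let ?e = "\<lambda>x. simple_root h x + simple_root Branch x + simple_root k x"
  have L: "m = l \<or> m = l' \<or> m = l''" for m
    using assms(4-6) by (cases m; cases l; cases l'; cases l'') auto
  have "pairing i ?e = - 1" "pairing Branch ?e = 0" "cartan Y i Branch = - 1"
    using assms by (simp_all add: pairing_path cartan_Y)
  then have "slide Branch i ?e = (\<lambda>x. ?e x + (simple_root i x + simple_root Branch x))"
    using slide_eq[of i Branch ?e] assms(1) by simp
  also have "\<dots> = theta i"
  proof
    fix x show "?e x + (simple_root i x + simple_root Branch x) = theta i x"
      using assms L by (cases x) (auto simp: simple_root_def)
  qed
  finally show ?thesis .
qed

text \<open>
  Here the shape of the tree enters.  A slide along the edge from \<open>j\<close> to \<open>i\<close> fixes a simple root that is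
  orthogonal to both, turns \<open>\<alpha>\<^sub>k\<close> for \<open>k\<close> beyond \<open>i\<close> into the path \<open>k\<close>--\<open>i\<close>--\<open>j\<close>, and the path
  \<open>i\<close>--\<open>j\<close>--\<open>m\<close> into \<open>\<alpha>\<^sub>m\<close>.  A path with middle vertex \<open>j\<close> that avoids \<open>i\<close> exists only if \<open>j\<close> is the
  branch vertex, and it becomes \<open>\<theta>\<^sub>i\<close>.  Along a leg \<open>\<theta>\<^sub>j\<close> becomes \<open>\<theta>\<^sub>i\<close>, and if \<open>i\<close> is the branch vertex
  it becomes the path that avoids \<open>j\<close>.
\<close>

lemma slide_elementary:
  assumes i: "i \<in> verts Y" and j: "j \<in> verts Y" and ij: "y_adj i j" and e: "e \<in> elementary j"
  shows "slide j i e \<in> elementary i"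
proof -
  have c: "cartan Y i j = - 1" using ij by (simp add: cartan_Y_edge)
  have ne: "i \<noteq> j" using ij y_adj_irrefl by auto
  have ji: "y_adj j i" using ij y_adj_sym by blast
  have sl: "slide j i e = (\<lambda>x. e x - pairing i e * (simple_root i x + simple_root j x))"
    using slide_eq[OF i j c elementary_orthogonal[OF j e]] .
  from e show ?thesis
  proof (cases rule: elementary_cases)
    case (simple k)
    then have pk: "pairing i e = cartan Y i k" by (simp add: pairing_simple i)
    show ?thesis
    proof (cases rule: cartan_cases[of i k])
      case 1
      then show ?thesis using simple ji ne by (simp add: cartan_Y)
    next
      case 2
      then have "slide j i e = e" using sl pk by simp
      then show ?thesis using elementary_simple[OF simple(1), of i] 2 simple by simp
    next
      case 3
      have "j \<noteq> k" using simple by (auto simp: cartan_Y)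
      moreover have "slide j i e = (\<lambda>x. simple_root k x + simple_root i x + simple_root j x)"
        unfolding sl using pk 3 simple by (intro ext) simp
      ultimately show ?thesis
        using elementary_path[of k j i] simple(1) j ij 3 by (auto simp: cartan_Y_edge)
    qed
  next
    case (path h k)
    note pe = pairing_path[OF i path(1) j path(2), folded path(6)]
    have across: "slide j i e = simple_root m"
      if "e = (\<lambda>x. simple_root i x + simple_root j x + simple_root m x)"
        "m \<in> verts Y" "m \<noteq> i" "y_adj j m" for m
    proof -
      have "\<not> y_adj i m" using no_triangle[OF ij that(4)] .
      then have "pairing i e = 1"
        unfolding that(1) using that ij ne by (simp add: pairing_path i j cartan_Y)
      then have "slide j i e x = simple_root m x" for x
        unfolding sl by (simp add: that(1)[THEN fun_cong])
      then show ?thesis by blast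
    qed
    have far: "cartan Y i m = 0" if "m \<noteq> i" "y_adj j m" for m
      using that no_triangle[OF ij that(2)] by (simp add: cartan_Y)
    consider "h = i" | "k = i" | "h \<noteq> i" "k \<noteq> i" by blast
    then show ?thesis
    proof cases
      case 1
      then have "slide j i e = simple_root k" using across[of k] path by simp
      then show ?thesis using far[of k] path 1 elementary_simple[of k i] by simp
    next
      case 2
      then have "slide j i e = simple_root h" using across[of h] path by (simp add: add_ac)
      then show ?thesis using far[of h] path 2 elementary_simple[of h i] by simp
    next
      case 3
      then have "j = Branch" using three_neighbours[of j h i k] path ji by auto
      then obtain l l' l'' where "i = Leg l 0" "h = Leg l' 0" "k = Leg l'' 0"
        using path ji by (cases i; cases h; cases k) auto
      moreover from this 3 path have "l \<noteq> l'" "l \<noteq> l''" "l' \<noteq> l''" by auto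
      ultimately have "slide j i e = theta i"
        using slide_path_to_theta path(6) \<open>j = Branch\<close> by blast
      then show ?thesis using elementary_theta[of i] \<open>j = Branch\<close> ne by simp
    qed
  next
    case theta
    then obtain l t where jl: "j = Leg l t" by (cases j) auto
    consider "i = Leg l (Suc t)" | s where "t = Suc s" "i = Leg l s" | "t = 0" "i = Branch"
      using ji unfolding jl y_adj_Leg by (cases t) auto
    then show ?thesis
    proof cases
      case 1
      then show ?thesis using slide_theta_outward[OF j jl i] theta elementary_theta[of i] by simp
    next
      case 2
      then show ?thesis using slide_theta_inward[of j l s i] j i jl theta elementary_theta[of i] by simp
    next
      case 3
      obtain l' l'' where L: "l \<noteq> l'" "l \<noteq> l''" "l' \<noteq> l''"
        by (rule two_other_legs)
      let ?e = "\<lambda>x. simple_root (Leg l' 0) x + simple_root Branch x + simple_root (Leg l'' 0) x"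
      have "slide Branch j ?e = theta j"
        using slide_path_to_theta[of j l "Leg l' 0" l' "Leg l'' 0" l''] L jl 3 by simp
      then have "slide j i e = slide j Branch (slide Branch j ?e)" using theta 3 by simp
      also have "\<dots> = ?e" using j by (intro slide_slide) auto
      finally show ?thesis using elementary_path[of "Leg l' 0" "Leg l'' 0" Branch] L 3 by simp
    qed
  qed
qed

lemma slide_bij_elementary:
  assumes "i \<in> verts Y" "j \<in> verts Y" "y_adj i j"
  shows "bij_betw (slide j i) (elementary j) (elementary i)"
proof (rule bij_betw_byWitness[where f' = "slide i j"])
  have "y_adj j i" using assms(3) y_adj_sym by blast
  then show "slide j i ` elementary j \<subseteq> elementary i" "slide i j ` elementary i \<subseteq> elementary j"
    using slide_elementary assms by blast+
qed (simp_all add: slide_slide assms)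

text \<open>
  At the branch vertex there are only simple roots and \<open>\<alpha>\<^sub>h + \<alpha>\<^sub>i + \<alpha>\<^sub>j = s\<^sub>js\<^sub>h\<alpha>\<^sub>i\<close>; slides carry this to the
  other vertices, including the roots \<open>\<theta>\<^sub>i\<close>.
\<close>

lemma elementary_stab_positive: "i \<in> verts Y \<Longrightarrow> elementary i \<subseteq> stab_positive_roots Y (simple_root i)"
proof (induction rule: Y_vertex_induct)
  case Branch
  show ?case
  proof
    fix e assume e: "e \<in> elementary Branch"
    then have "pos e"
    proof (cases rule: elementary_cases)
      case (simple j)
      then show ?thesis by (simp add: pos.simple)
    next
      case (path h j)
      have "\<not> y_adj j h" using no_triangle[of j Branch h] path y_adj_sym by blast
      then have ch: "cartan Y h Branch = - 1" "cartan Y j Branch = - 1" "cartan Y j h = 0"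
        using path by (simp_all add: cartan_Y y_adj_sym[of h Branch] y_adj_sym[of j Branch]) auto
      then have "pos (sref j (sref h (simple_root Branch)))"
        using path by (intro pos.raise pos.simple) (simp_all add: pairing_sref pairing_simple)
      moreover have "sref j (sref h (simple_root Branch)) = e"
        using path ch by (intro ext) (simp add: sref_apply pairing_sref pairing_simple)
      ultimately show ?thesis by simp
    qed simp
    then show "e \<in> stab_positive_roots Y (simple_root Branch)"
      using elementary_orthogonal[OF _ e] by (simp add: stab_positive_iff)
  qed
next
  case (edge i j)
  then have "elementary i = slide j i ` elementary j" using slide_bij_elementary bij_betw_imp_surj_on by metis
  then show ?case
    using slide_stab_positive[OF edge(1,2)] edge by (auto simp: cartan_Y_edge)
qed

lemma elementary_roots_eq: "i \<in> verts Y \<Longrightarrow> elementary_roots a b c i = elementary i"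
proof -
  assume i: "i \<in> verts Y"
  have "elementary i \<subseteq> positive_roots Y"
    using elementary_stab_positive[OF i] by (auto simp: stab_positive_roots_def)
  moreover have "elementary_roots a b c i = positive_roots Y \<inter> elementary i"
    unfolding elementary_roots_def elementary_def using D_highest_root_theta[of i]
    by (auto simp: adj_Y)
  ultimately show ?thesis by blast
qed

section \<open>Identification of the simple roots, and their number\<close>

text \<open>
  An indexing of the elementary roots at the branch vertex by the other vertices: a neighbour \<open>Leg l 0\<close>
  stands for the path through the two other neighbours, any further vertex for its own simple root.
\<close>

fun branch_elem :: "yvertex \<Rightarrow> yvertex \<Rightarrow> real" where
  "branch_elem (Leg l 0) = (\<lambda>x. if x = Branch \<or> (\<exists>l'. l' \<noteq> l \<and> x = Leg l' 0) then 1 else 0)"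
| "branch_elem (Leg l (Suc t)) = simple_root (Leg l (Suc t))"
| "branch_elem Branch = simple_root Branch"

text \<open>
  Each elementary root at the branch vertex has coordinate 1 at exactly one vertex that is not a neighbour
  of the branch vertex: a path at the branch vertex itself, a simple root at its own vertex.
\<close>

lemma elementary_Branch_functional:
  assumes "e \<in> elementary Branch"
  shows "(\<Sum>x | x \<in> verts Y \<and> \<not> y_adj Branch x. e x) = 1"
proof -
  let ?N = "{x \<in> verts Y. \<not> y_adj Branch x}"
  have *: "(\<Sum>x\<in>?N. simple_root k x) = (if k \<in> ?N then 1 else 0)" for k
    using fin by (simp add: simple_root_def)
  from assms show ?thesis
  proof (cases rule: elementary_cases)
    case (simple j)
    then have "j \<in> ?N" by (auto simp: cartan_Y split: if_splits)
    then show ?thesis using * simple by simp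
  next
    case (path h j)
    then show ?thesis using * by (simp add: sum.distrib)
  qed simp
qed

lemma elementary_functional:
  assumes "i \<in> verts Y"
  shows "\<exists>f. linear_functional f \<and> (\<forall>e\<in>elementary i. f e = 1)"
  using assms
proof (induction rule: Y_vertex_induct)
  case Branch
  have "linear_functional (\<lambda>v. \<Sum>x | x \<in> verts Y \<and> \<not> y_adj Branch x. v x)"
    unfolding linear_functional_def by (auto simp: sum_distrib_left intro: sum.swap)
  then show ?case using elementary_Branch_functional by blast
next
  case (edge i j)
  then obtain f where f: "linear_functional f" "\<forall>e\<in>elementary j. f e = 1" by blast
  have "f (slide i j e) = 1" if "e \<in> elementary i" for e
    using f(2) slide_elementary[of j i e] that edge y_adj_sym by blast
  then show ?case using linear_functional_slide[OF f(1), of i j] by blast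
qed

lemma stab_simple_roots_eq:
  assumes i: "i \<in> verts Y"
  shows "stab_simple_roots Y (simple_root i) = elementary i"
proof -
  obtain f where f: "linear_functional f" "\<forall>e\<in>elementary i. f e = 1" using elementary_functional[OF i] by blast
  have "stab_positive_roots Y (simple_root i) \<subseteq> nat_span (elementary i)"
  proof
    fix \<beta> assume \<beta>: "\<beta> \<in> stab_positive_roots Y (simple_root i)"
    show "\<beta> \<in> nat_span (elementary i)"
      by (rule stab_positive_in_nat_span[where E = elementary, OF _ _ _ i \<beta>])
        (simp_all add: finite_elementary elementary_simple slide_elementary cartan_Y_edge)
  qed
  then show ?thesis
    using stab_simple_roots_eqI[OF finite_elementary elementary_stab_positive[OF i] _ f(1)] f(2) by blast
qed

lemma branch_elem_0:
  assumes "l \<noteq> l'" "l \<noteq> l''" "l' \<noteq> l''"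
  shows "branch_elem (Leg l 0) =
    (\<lambda>x. simple_root (Leg l' 0) x + simple_root Branch x + simple_root (Leg l'' 0) x)"
proof
  fix x
  have L: "m = l \<or> m = l' \<or> m = l''" for m
    using assms by (cases m; cases l; cases l'; cases l'') auto
  show "branch_elem (Leg l 0) x =
      simple_root (Leg l' 0) x + simple_root Branch x + simple_root (Leg l'' 0) x"
    using assms L by (cases x) (auto simp: simple_root_def)
qed

lemma branch_elem_bij: "bij_betw branch_elem (verts Y - {Branch}) (elementary Branch)"
proof -
  have inj: "inj_on branch_elem (verts Y - {Branch})"
  proof (rule inj_onI)
    fix x y assume "x \<in> verts Y - {Branch}" "y \<in> verts Y - {Branch}" and eq: "branch_elem x = branch_elem y"
    then obtain l t l' t' where x: "x = Leg l t" and y: "y = Leg l' t'"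
      by (cases x; cases y) auto
    have "branch_elem x z = branch_elem y z" for z using eq by simp
    \<comment> \<open>The coordinate at the branch vertex separates paths from simple roots, and the path indexed by
      a neighbour is the only one whose coordinate there vanishes.\<close>
    from this[of x] this[of y] this[of Branch] show "x = y"
      unfolding x y by (cases t; cases t') (auto simp: simple_root_def split: if_splits)
  qed
  have "branch_elem ` (verts Y - {Branch}) = elementary Branch"
  proof (intro subset_antisym subsetI)
    fix e assume "e \<in> branch_elem ` (verts Y - {Branch})"
    then obtain x where "x \<in> verts Y - {Branch}" "e = branch_elem x" by blast
    then obtain l t where lt: "Leg l t \<in> verts Y" "e = branch_elem (Leg l t)"
      by (cases x) auto
    show "e \<in> elementary Branch"
    proof (cases t)
      case 0
      obtain l' l'' where L: "l \<noteq> l'" "l \<noteq> l''" "l' \<noteq> l''"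
        by (rule two_other_legs)
      show ?thesis
        using elementary_path[of "Leg l' 0" "Leg l'' 0" Branch] L branch_elem_0[OF L] lt 0 by simp
    next
      case (Suc s)
      then show ?thesis using elementary_simple[OF lt(1), of Branch] lt by (simp add: cartan_Y)
    qed
  next
    fix e assume "e \<in> elementary Branch"
    then show "e \<in> branch_elem ` (verts Y - {Branch})"
    proof (cases rule: elementary_cases)
      case (simple j)
      have "\<exists>l t. j = Leg l (Suc t)"
      proof (cases j)
        case (Leg l t)
        then show ?thesis using simple(2) by (cases t) (simp_all add: cartan_Y)
      qed (use simple(2) in \<open>simp add: cartan_Y\<close>)
      then obtain l t where "j = Leg l (Suc t)" by blast
      then show ?thesis using simple by (intro image_eqI[of _ _ j]) auto
    next
      case (path h j)
      then obtain l' l'' where hj: "h = Leg l' 0" "j = Leg l'' 0" "l' \<noteq> l''"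
        by (cases h; cases j) auto
      have "\<exists>l\<in>{LegA, LegB, LegC}. l \<noteq> l' \<and> l \<noteq> l''" by (cases l'; cases l'') simp_all
      then obtain l where "l \<noteq> l'" "l \<noteq> l''" by blast
      then show ?thesis using branch_elem_0[of l l' l''] hj path by (intro image_eqI[of _ _ "Leg l 0"]) auto
    qed simp
  qed
  then show ?thesis using inj by (simp add: bij_betw_def)
qed

lemma card_elementary: "i \<in> verts Y \<Longrightarrow> card (elementary i) = a + b + c"
proof (induction rule: Y_vertex_induct)
  case Branch
  have "card (verts Y - {Branch}) = a + b + c" using card_verts_Y[of a b c] by simp
  then show ?case using bij_betw_same_card[OF branch_elem_bij] by simp
next
  case (edge i j)
  then show ?case using bij_betw_same_card[OF slide_bij_elementary[OF edge(1-3)]] by simp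
qed

section \<open>The type of the stabilizer\<close>

abbreviation H :: "(nat \<times> nat) graph" where
  "H \<equiv> H_diagram (int a - 2) (int b - 2) (int c - 2)"

text \<open>
  Composed with \<open>branch_elem\<close> this places the three paths at \<open>h\<^sub>2\<close>, \<open>h\<^sub>4\<close>, \<open>h\<^sub>6\<close> and the second vertices of
  the legs at \<open>h\<^sub>1\<close>, \<open>h\<^sub>3\<close>, \<open>h\<^sub>5\<close>.  The path that avoids a leg goes opposite to that leg, since it is
  orthogonal to the second vertex of the leg, while the two other paths pair to -1 with it.
\<close>

fun h_vertex :: "nat \<times> nat \<Rightarrow> yvertex" where
  "h_vertex (k, t) =
     (if k = 1 then Leg LegA (Suc t) else if k = 3 then Leg LegB (Suc t) else
      if k = 5 then Leg LegC (Suc t) else if k = 2 then Leg LegC 0 else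
      if k = 4 then Leg LegA 0 else Leg LegB 0)"

lemma verts_H:
  "(k, t) \<in> verts H \<longleftrightarrow> k = 1 \<and> Suc t < a \<or> k = 3 \<and> Suc t < b \<or> k = 5 \<and> Suc t < c \<or>
     t = 0 \<and> k \<in> {2, 4, 6}"
  by (auto simp: H_diagram_def h_length_def)

lemma h_vertex_bij: "bij_betw h_vertex (verts H) (verts Y - {Branch})"
proof (rule bij_betw_imageI)
  show "inj_on h_vertex (verts H)"
    by (rule inj_onI) (auto simp: verts_H)
  show "h_vertex ` verts H = verts Y - {Branch}"
  proof (intro subset_antisym subsetI)
    fix x assume "x \<in> h_vertex ` verts H"
    then show "x \<in> verts Y - {Branch}"
      using leg_lengths by (auto simp: verts_H Leg_in)
  next
    fix x assume x: "x \<in> verts Y - {Branch}"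
    then obtain l t where lt: "x = Leg l t" "t < leg_length a b c l"
      by (cases x) (auto simp: Leg_in)
    define p where "p = (case (l, t) of
      (LegA, 0) \<Rightarrow> (4, 0) | (LegA, Suc s) \<Rightarrow> (1, s) | (LegB, 0) \<Rightarrow> (6, 0) |
      (LegB, Suc s) \<Rightarrow> (3, s) | (LegC, 0) \<Rightarrow> (2, 0) | (LegC, Suc s) \<Rightarrow> (5::nat, s))"
    have "p \<in> verts H \<and> h_vertex p = x"
      using lt by (cases l; cases t) (auto simp: p_def verts_H)
    then show "x \<in> h_vertex ` verts H" by blast
  qed
qed

text \<open>
  The branch vertex contributes nothing, because \<open>v\<close> is orthogonal to its simple root.
\<close>

lemma bform_branch_elem_0:
  assumes v: "v \<in> elementary Branch"
  shows "bform Y (branch_elem (Leg l 0)) v =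
    (\<Sum>l'\<in>{LegA, LegB, LegC} - {l}. pairing (Leg l' 0) v)"
proof -
  have *: "bform Y (branch_elem (Leg l 0)) v = pairing (Leg l' 0) v + pairing (Leg l'' 0) v"
    if "l \<noteq> l'" "l \<noteq> l''" "l' \<noteq> l''" for l' l''
    unfolding branch_elem_0[OF that]
    using bform_lin_left[of Y "\<lambda>x. simple_root (Leg l' 0) x + simple_root Branch x" "- 1" "simple_root (Leg l'' 0)" v]
      bform_lin_left[of Y "simple_root (Leg l' 0)" "- 1" "simple_root Branch" v]
      elementary_orthogonal[OF Branch_in v]
    by simp
  show ?thesis
  proof (cases l)
    case LegA
    then have "{LegA, LegB, LegC} - {l} = {LegB, LegC}" by auto
    then show ?thesis using *[of LegB LegC] LegA by simp
  next
    case LegB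
    then have "{LegA, LegB, LegC} - {l} = {LegA, LegC}" by auto
    then show ?thesis using *[of LegA LegC] LegB by simp
  next
    case LegC
    then have "{LegA, LegB, LegC} - {l} = {LegA, LegB}" by auto
    then show ?thesis using *[of LegA LegB] LegC by simp
  qed
qed

lemma pairing_branch_elem:
  assumes "Leg m s \<in> verts Y"
  shows "pairing (Leg l 0) (branch_elem (Leg m s)) =
    (if s = 0 then if l = m then - 1 else 1
     else if l = m \<and> s = 1 then - 1 else 0)"
proof (cases s)
  case 0
  have "branch_elem (Leg m 0) x = 0" if "x \<notin> verts Y" for x
    using that by auto
  then show ?thesis using pairing_Leg[of l 0 "branch_elem (Leg m 0)"] 0 by simp
next
  case (Suc s')
  then show ?thesis using assms by (auto simp: pairing_simple cartan_Y)
qed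

lemma bform_branch_elem_Y:
  assumes "Leg l t \<in> verts Y" "Leg m s \<in> verts Y"
  shows "bform Y (branch_elem (Leg l t)) (branch_elem (Leg m s)) =
    (if l = m then
       if t = s then 2 else if t \<noteq> 0 \<and> s \<noteq> 0 \<and> (t = Suc s \<or> s = Suc t) then - 1 else 0
     else if t = 0 \<and> s = 1 \<or> t = 1 \<and> s = 0 then - 1 else 0)"
proof -
  have in_el: "branch_elem (Leg l t) \<in> elementary Branch" if "Leg l t \<in> verts Y" for l t
    using bij_betwE[OF branch_elem_bij] that by blast
  have *: "bform Y (branch_elem (Leg l 0)) (branch_elem (Leg m s)) =
    (if s = 0 then if l = m then 2 else 0 else if l \<noteq> m \<and> s = 1 then - 1 else 0)"
    if "Leg m s \<in> verts Y" for l m s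
    unfolding bform_branch_elem_0[OF in_el[OF that]] pairing_branch_elem[OF that]
    by (cases l; cases m) (simp_all add: insert_Diff_if)
  show ?thesis
  proof (cases t)
    case 0
    then show ?thesis using *[OF assms(2), of l] by auto
  next
    case (Suc t')
    show ?thesis
    proof (cases s)
      case 0
      then show ?thesis
        using *[OF assms(1), of m] Suc
          bform_sym[OF adj_sym, of "branch_elem (Leg l t)" "branch_elem (Leg m s)"] by auto
    next
      case (Suc s')
      then show ?thesis
        using \<open>t = Suc t'\<close> assms by (auto simp: pairing_simple cartan_Y)
    qed
  qed
qed

lemma bform_branch_elem:
  assumes "p \<in> verts H" "q \<in> verts H"
  shows "bform Y (branch_elem (h_vertex p)) (branch_elem (h_vertex q)) = cartan H p q"
proof -
  obtain k t k' t' where p: "p = (k, t)" and q: "q = (k', t')" by (cases p; cases q) auto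
  have v: "h_vertex p \<in> verts Y" "h_vertex q \<in> verts Y"
    using assms bij_betwE[OF h_vertex_bij] by auto
  have "k \<in> {1, 2, 3, 4, 5, 6}" "k' \<in> {1, 2, 3, 4, 5, 6}" using assms p q by (auto simp: verts_H)
  moreover have "adj H = h_adj" by (simp add: H_diagram_def)
  ultimately show ?thesis
    using assms v unfolding p q
    by (elim insertE emptyE)
      (simp_all add: bform_branch_elem_Y cartan_def h_adj_def verts_H del: branch_elem.simps)
qed

lemma has_type_elementary: "i \<in> verts Y \<Longrightarrow> has_type Y (elementary i) H"
proof (induction rule: Y_vertex_induct)
  case Branch
  have "bij_betw (branch_elem \<circ> h_vertex) (verts H) (elementary Branch)"
    using bij_betw_trans[OF h_vertex_bij branch_elem_bij] .
  then show ?case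
    unfolding has_type_def using bform_branch_elem by (intro exI[of _ "branch_elem \<circ> h_vertex"]) simp
next
  case (edge i j)
  then obtain \<phi> where "bij_betw \<phi> (verts H) (elementary j)"
    and "\<forall>u\<in>verts H. \<forall>v\<in>verts H. bform Y (\<phi> u) (\<phi> v) = cartan H u v"
    unfolding has_type_def by blast
  moreover from this(1) have "bij_betw (slide j i \<circ> \<phi>) (verts H) (elementary i)"
    using bij_betw_trans slide_bij_elementary[OF edge(1-3)] by blast
  ultimately show ?case
    unfolding has_type_def using edge(1,2)
    by (intro exI[of _ "slide j i \<circ> \<phi>"]) (simp add: bform_slide)
qed

end

theorem theorem2p7:
  fixes a b c n :: nat
  assumes "1 \<le> a" and "1 \<le> b" and "1 \<le> c" and "n = a + b + c + 1"
  shows "(\<forall>i\<in>verts (Y_diagram a b c).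
      has_type (Y_diagram a b c) (stab_simple_roots (Y_diagram a b c) (simple_root i))
        (H_diagram (int a - 2) (int b - 2) (int c - 2)) \<and>
      stab_simple_roots (Y_diagram a b c) (simple_root i) = elementary_roots a b c i \<and>
      card (elementary_roots a b c i) = n - 1) \<and>
    canonical_basis a b c =
      {sym_product (simple_root i) \<beta> | i \<beta>.
         i \<in> verts (Y_diagram a b c) \<and>
         \<beta> \<in> stab_simple_roots (Y_diagram a b c) (simple_root i)}"
proof -
  interpret Y_tree a b c using assms by unfold_locales
  have "stab_simple_roots Y (simple_root i) = elementary_roots a b c i" if "i \<in> verts Y" for i
    using that by (simp add: stab_simple_roots_eq elementary_roots_eq)
  then have "canonical_basis a b c =
      {sym_product (simple_root i) \<beta> | i \<beta>.
         i \<in> verts Y \<and> \<beta> \<in> stab_simple_roots Y (simple_root i)}"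
    unfolding canonical_basis_def by (metis (no_types, lifting))
  moreover have "\<forall>i\<in>verts Y. has_type Y (stab_simple_roots Y (simple_root i)) H \<and>
      stab_simple_roots Y (simple_root i) = elementary_roots a b c i \<and>
      card (elementary_roots a b c i) = n - 1"
    using has_type_elementary card_elementary assms(4)
    by (simp add: stab_simple_roots_eq elementary_roots_eq)
  ultimately show ?thesis by blast
qed

end
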